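(* There exists a Tychonoff, pseudocompact, non-metrizable topological space $P$ such that $P$ has a sharp base, $P$ does not have a $G_\delta^*$-diagonal, and the product $P\times[0,1]$ (where $[0,1]$ is the closed unit interval with its usual topology) does not have a sharp base.
   Context: All spaces are $T_1$ topological spaces; $\omega=\{0,1,2,\dots\}$. A base $\mathcal{B}$ for a space $X$ is sharp if, whenever $x\in X$ and $(B_n)_{n\in\omega}$ is a sequence of pairwise distinct elements of $\mathcal{B}$ each containing $x$, the collection $\{\bigcap_{j\le n}B_j:n\in\omega\}$ is a local base at $x$. A space is pseudocompact if every continuous real-valued function on it is bounded. A space $X$ has a $G_\delta^*$-diagonal if there is a sequence $(\mathcal{G}_n)_{n\in\omega}$ of open covers of $X$ such that $\bigcap_{n\in\omega}\overline{\mathrm{st}(x,\mathcal{G}_n)}=\{x\}$ for every $x\in X$, where $\mathrm{st}(x,\mathcal{G}_n)=\bigcup\{G\in\mathcal{G}_n:x\in G\}$. *)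

theory Defs
  imports "HOL-Analysis.Analysis"
begin

definition tychonoff_space :: "'a topology \<Rightarrow> bool" where
  "tychonoff_space X \<longleftrightarrow> t1_space X \<and> completely_regular_space X"

definition pseudocompact_space :: "'a topology \<Rightarrow> bool" where
  "pseudocompact_space X \<longleftrightarrow>
     (\<forall>f. continuous_map X euclideanreal f \<longrightarrow> bounded (f ` topspace X))"

text \<open>The library expresses that a family is a base through \<open>arbitrary union_of\<close>
  (see for instance \<open>second_countable\<close>): the open sets are exactly the unions of
  subfamilies.\<close>

definition base_for :: "'a topology \<Rightarrow> 'a set set \<Rightarrow> bool" where
  "base_for X \<B> \<longleftrightarrow> openin X = arbitrary union_of (\<lambda>U. U \<in> \<B>)"

definition local_base_at :: "'a topology \<Rightarrow> 'a \<Rightarrow> 'a set set \<Rightarrow> bool" where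
  "local_base_at X x \<L> \<longleftrightarrow>
     (\<forall>V\<in>\<L>. openin X V \<and> x \<in> V) \<and>
     (\<forall>U. openin X U \<and> x \<in> U \<longrightarrow> (\<exists>V\<in>\<L>. V \<subseteq> U))"

definition sharp_base :: "'a topology \<Rightarrow> 'a set set \<Rightarrow> bool" where
  "sharp_base X \<B> \<longleftrightarrow>
     base_for X \<B> \<and>
     (\<forall>x\<in>topspace X. \<forall>B :: nat \<Rightarrow> 'a set.
        inj B \<and> (\<forall>n. B n \<in> \<B> \<and> x \<in> B n) \<longrightarrow>
        local_base_at X x (range (\<lambda>n. \<Inter>j\<le>n. B j)))"

definition has_sharp_base :: "'a topology \<Rightarrow> bool" where
  "has_sharp_base X \<longleftrightarrow> (\<exists>\<B>. sharp_base X \<B>)"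

definition open_cover :: "'a topology \<Rightarrow> 'a set set \<Rightarrow> bool" where
  "open_cover X \<G> \<longleftrightarrow> (\<forall>G\<in>\<G>. openin X G) \<and> \<Union>\<G> = topspace X"

definition star :: "'a \<Rightarrow> 'a set set \<Rightarrow> 'a set" where
  "star x \<G> = \<Union>{G \<in> \<G>. x \<in> G}"

definition has_G_delta_star_diagonal :: "'a topology \<Rightarrow> bool" where
  "has_G_delta_star_diagonal X \<longleftrightarrow>
     (\<exists>\<G> :: nat \<Rightarrow> 'a set set.
        (\<forall>n. open_cover X (\<G> n)) \<and>
        (\<forall>x\<in>topspace X. (\<Inter>n. X closure_of (star x (\<G> n))) = {x}))"

text \<open>HOL cannot quantify existentially over types, so an existence statement about
  topological spaces has to name a type of points.  A space in the sense of
  \<^typ>\<open>'a topology\<close> has an arbitrary subset of \<^typ>\<open>'a\<close> as its underlying set, hence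
  \<^typ>\<open>real set topology\<close> covers, up to homeomorphism, all spaces with at most
  \<open>2\<^sup>\<cc>\<close> points, where \<open>\<cc>\<close> is the cardinality of the continuum.\<close>

end

theory Submission
  imports Defs "HOL-Library.Sublist"
begin

text \<open>The space is a tree space with limit points added.  Let \<open>D\<close> be an uncountable set of letters, and
take as dense part the branches \<open>x : \<nat> \<rightarrow> D\<close> of the tree of finite words (nodes) over \<open>D\<close>.
A fan is a node, its stem, together with a sequence of nodes, its tips, that extend
pairwise distinct immediate successors of the stem.  For each fan of a suitable family
a point is added, whose basic neighbourhoods consist of the point itself and the cylinders over
all tips from some index on.

Three properties of the family do all the work.

\<^item> The last letter of every tip of a fan is a code of that fan, so each node is a tip of at most
  one fan.

\<^item> Two selected fans with the same stem have at most one pair of comparable tips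
  (\<open>selected_compat\<close>).

\<^item> The family is maximal: any sequence of nodes in distinct directions above a
  node \<open>s\<close> has infinitely many terms comparable to tips of one selected fan with stem \<open>s\<close>
  (\<open>selected_maximal\<close>).

The first two give the sharp base: among infinitely many basic sets around a branch \<open>x\<close>, either
there is one over a long node, or two of them come from different fans with the same stem and with
long tips below \<open>x\<close>, and then their intersection lies in the cylinder over such a tip.  Maximality gives pseudocompactness,
because every sequence of nonempty open sets accumulates somewhere (\<open>nodes_accumulate\<close>).

The two negative results come from the same source.  As \<open>D\<close> is uncountable, maximality
can be strengthened: if nodes are prescribed above uncountably many directions, then one selected
fan with empty stem has tips extending infinitely many of them (\<open>selected_uncountable\<close>).  So
whatever neighbourhoods are assigned to the fan points, there is a branch \<open>x\<close> that is
caught again and again by assigned neighbourhoods of fan points with empty stem.  Such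
neighbourhoods always reach into other directions.  For a sequence of open covers, this
produces an accumulation point \<open>q \<noteq> x\<close> in the closures of all stars of \<open>x\<close>; thus there is no
\<open>G\<^sub>\<delta>\<^sup>*\<close>-diagonal, and hence no metric.  For a base of the product with \<open>[0,1]\<close>, one chooses around
each \<open>(p, 1/2)\<close> a basic set, which contains a rectangle with some positive height; infinitely
many of the rectangles over \<open>x\<close> have height bounded below, so the intersection of the corresponding
basic sets contains, besides \<open>(x, 1/2)\<close>, another point of \<open>{x} \<times> [0,1]\<close>, and the base is not sharp.\<close>

section \<open>Letters\<close>

unbundle cardinal_syntax

text \<open>A letter encodes a sequence of words over letters.  Being an inductive type, it makes the alphabet
closed under coding of sequences, while a letter never occurs in the sequence that it
encodes.  The word at index \<open>0\<close> will be the stem of a fan, the others determine its tips.\<close>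

datatype letter = Seq "nat \<Rightarrow> letter list"

type_synonym node = "letter list"

text \<open>A letter is an infinitely branching well-founded tree; following a finite
path of positions in it and recording whether the position exists determines the letter.
So a letter amounts to a set of natural numbers, and the points of the space fit into
\<^typ>\<open>real set\<close>.\<close>

primrec path_code :: "(nat \<times> nat) list \<Rightarrow> letter \<Rightarrow> nat" where
  "path_code [] a = 0"
| "path_code (p # ps) a = (case a of Seq g \<Rightarrow>
     if snd p < length (g (fst p)) then Suc (path_code ps (g (fst p) ! snd p)) else 0)"

lemma path_code_inject: "(\<And>ps. path_code ps a = path_code ps b) \<Longrightarrow> a = b"
proof (induction a arbitrary: b)
  case (Seq g)
  obtain h where b: "b = Seq h" by (cases b)
  have lt: "i < length (g n) \<longleftrightarrow> i < length (h n)" for i n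
    using Seq.prems[of "[(n, i)]"] by (auto simp: b split: if_splits)
  have len: "length (g n) = length (h n)" for n
    using lt[of _ n] by (meson linorder_neqE_nat nat_less_le)
  have "g n = h n" for n
  proof (rule nth_equalityI[OF len])
    fix i assume i: "i < length (g n)"
    have "path_code ps (g n ! i) = path_code ps (h n ! i)" for ps
      using Seq.prems[of "(n, i) # ps"] i len by (simp add: b)
    then show "g n ! i = h n ! i"
      using Seq.IH[of "g n" "g n ! i"] i by auto
  qed
  then show ?case by (auto simp: b)
qed

definition encode :: "letter \<Rightarrow> real set" where
  "encode a = range (\<lambda>ps. real (to_nat (ps, path_code ps a)))"

lemma encode_inject [simp]: "encode a = encode b \<longleftrightarrow> a = b"
proof
  assume eq: "encode a = encode b"
  show "a = b"
  proof (rule path_code_inject)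
    fix ps
    have "real (to_nat (ps, path_code ps a)) \<in> encode b"
      unfolding eq[symmetric] by (auto simp: encode_def)
    then show "path_code ps a = path_code ps b"
      by (auto simp: encode_def)
  qed
qed simp

lemma uncountable_letter: "\<not> countable (UNIV :: letter set)"
proof
  assume c: "countable (UNIV :: letter set)"
  define f where "f A = Seq (\<lambda>n. if n \<in> A then [] else [Seq (\<lambda>_. [])])" for A :: "nat set"
  have "inj f"
  proof (rule injI)
    fix A B assume "f A = f B"
    then have "(if n \<in> A then [] else [Seq (\<lambda>_. [])]) = (if n \<in> B then [] else [Seq (\<lambda>_. [])])" for n
      unfolding f_def letter.inject by (rule fun_cong)
    then have "n \<in> A \<longleftrightarrow> n \<in> B" for n
      by (metis list.distinct(1))
    then show "A = B" by blast
  qed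
  then have "countable (UNIV :: nat set set)"
    using c by (metis countable_image_inj_on countable_subset subset_UNIV)
  then obtain g :: "nat \<Rightarrow> nat set" where "range g = UNIV"
    using uncountable_def[of "UNIV :: nat set set"] by auto
  then show False
    using Cantors_theorem[of "UNIV :: nat set"] by auto
qed

section \<open>Fans\<close>

primrec stem :: "letter \<Rightarrow> node" where
  "stem (Seq g) = g 0"

primrec prong :: "letter \<Rightarrow> nat \<Rightarrow> node" where
  "prong (Seq g) n = g (Suc n)"

text \<open>The code of the fan is appended, so that no other fan has this node as a tip.\<close>

definition tip :: "letter \<Rightarrow> nat \<Rightarrow> node" where
  "tip a n = prong a n @ [a]"

definition dir :: "letter \<Rightarrow> nat \<Rightarrow> letter" where
  "dir a n = tip a n ! length (stem a)"

definition fan :: "letter \<Rightarrow> bool" where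
  "fan a \<longleftrightarrow> (\<forall>n. strict_prefix (stem a) (prong a n)) \<and> inj (dir a)"

abbreviation comparable :: "node \<Rightarrow> node \<Rightarrow> bool" where
  "comparable u v \<equiv> prefix u v \<or> prefix v u"

text \<open>Only fans with equal stems need this almost-disjointness: for different stems,
the tree order alone keeps all but at most one tip of one of the fans away from the other.\<close>

definition compat :: "letter \<Rightarrow> letter \<Rightarrow> bool" where
  "compat a b \<longleftrightarrow> (stem a = stem b \<longrightarrow> (\<forall>m n m' n'.
     comparable (tip a m) (tip b n) \<and> comparable (tip a m') (tip b n') \<longrightarrow> m = m' \<and> n = n'))"

section \<open>A well-order in which fans precede the fans that mention them\<close>

text \<open>The order type of the ranks only has to be one in which countable sets are strictly bounded.\<close>

abbreviation omega1 :: "nat set rel" where "omega1 \<equiv> cardSuc natLeq"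

lemma omega1_bound:
  assumes "countable C" "C \<subseteq> Field omega1"
  shows "\<exists>w \<in> Field omega1. \<forall>c \<in> C. (c, w) \<in> omega1 - Id"
proof -
  have card: "Card_order omega1"
    by (simp add: cardSuc_Card_order natLeq_Card_order)
  have inf: "\<not> finite (Field omega1)"
    using cardSuc_finite[OF natLeq_Card_order] by (simp add: Field_natLeq)
  have wo: "Well_order omega1" using card card_order_on_well_order_on by blast
  have tr: "trans omega1" and an: "antisym omega1"
    using wo unfolding well_order_on_def linear_order_on_def partial_order_on_def preorder_on_def by auto
  have rc: "relChain omega1 (\<lambda>w. {c. (c, w) \<in> omega1})"
    using tr unfolding relChain_def by (auto dest: transD)
  have sub: "C \<subseteq> (\<Union>w \<in> Field omega1. {c. (c, w) \<in> omega1})"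
    using assms(2) wo unfolding well_order_on_def linear_order_on_def partial_order_on_def preorder_on_def refl_on_def
    by blast
  have "|C| \<le>o natLeq"
    using assms(1) card_of_ordLeq[of C "UNIV :: nat set"] ordLeq_ordIso_trans[OF _ card_of_nat]
    by (auto simp: countable_def)
  then obtain w where w: "w \<in> Field omega1" "C \<subseteq> {c. (c, w) \<in> omega1}"
    using cardSuc_UNION[OF natLeq_Card_order _ rc sub] by (auto simp: Field_natLeq)
  obtain w' where w': "w' \<in> Field omega1" "w \<noteq> w'" "(w, w') \<in> omega1"
    using infinite_Card_order_limit[OF card inf w(1)] by auto
  have "(c, w') \<in> omega1 - Id" if "c \<in> C" for c
    using w(2) w' that tr an by (auto dest: transD antisymD)
  then show ?thesis using w'(1) by blast
qed

definition strict_bound :: "nat set set \<Rightarrow> nat set" where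
  "strict_bound C = (SOME w. w \<in> Field omega1 \<and> (\<forall>c \<in> C. (c, w) \<in> omega1 - Id))"

primrec letter_rank :: "letter \<Rightarrow> nat set" where
  "letter_rank (Seq g) = strict_bound (\<Union>n. set (map letter_rank (g n)))"

lemma letter_rank_less:
  "letter_rank (Seq g) \<in> Field omega1 \<and> (\<forall>n. \<forall>b \<in> set (g n). (letter_rank b, letter_rank (Seq g)) \<in> omega1 - Id)"
proof -
  have F: "letter_rank a \<in> Field omega1" for a
  proof (induction a)
    case (Seq g)
    let ?C = "\<Union>n. set (map letter_rank (g n))"
    have "countable ?C" "?C \<subseteq> Field omega1"
      using Seq by (auto simp: countable_finite)
    from someI_ex[OF omega1_bound[OF this, unfolded Bex_def]]
    show ?case by (auto simp: strict_bound_def)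
  qed
  let ?C = "\<Union>n. set (map letter_rank (g n))"
  have "countable ?C" "?C \<subseteq> Field omega1"
    using F by (auto simp: countable_finite)
  from someI_ex[OF omega1_bound[OF this, unfolded Bex_def]]
  have "strict_bound ?C \<in> Field omega1 \<and> (\<forall>c\<in>?C. (c, strict_bound ?C) \<in> omega1 - Id)"
    unfolding strict_bound_def by blast
  then show ?thesis by auto
qed

lemma letter_rank_prong: "b \<in> set (prong a n) \<Longrightarrow> (letter_rank b, letter_rank a) \<in> omega1 - Id"
  using letter_rank_less by (cases a) auto

text \<open>Maximality will be proved by adding a new fan \<open>a\<close>, and the only obstacle that cannot be
avoided by thinning out is a fan \<open>b\<close> whose tips extend tips of \<open>a\<close>.  Then the code of \<open>a\<close> occurs in
a prong of \<open>b\<close>.  A well-order in which such \<open>b\<close> come after \<open>a\<close> makes a greedy selection work.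
It orders by rank first and breaks ties by an arbitrary well-order.\<close>

lemma letter_order_exists:
  "\<exists>r :: letter rel. wf r \<and> total r \<and> (\<forall>a b n. b \<in> set (prong a n) \<longrightarrow> (b, a) \<in> r)"
proof -
  obtain q :: "letter rel" where q: "well_order_on UNIV q"
    using well_order_on by blast
  have o: "Well_order omega1"
    using cardSuc_Card_order[OF natLeq_Card_order] card_order_on_well_order_on by blast
  have tot: "(w, w') \<in> omega1 \<or> (w', w) \<in> omega1" if "w \<in> Field omega1" "w' \<in> Field omega1" "w \<noteq> w'" for w w'
    using o that unfolding well_order_on_def linear_order_on_def total_on_def by blast
  have F: "letter_rank a \<in> Field omega1" for a
    using letter_rank_less by (cases a) blast
  let ?r = "inv_image ((omega1 - Id) <*lex*> (q - Id)) (\<lambda>a. (letter_rank a, a))"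
  have "wf ?r"
    using q o by (intro wf_inv_image wf_lex_prod) (auto simp: well_order_on_def)
  moreover have "total ?r"
  proof (rule totalI)
    fix a b :: letter assume "a \<noteq> b"
    then have "(a, b) \<in> q \<or> (b, a) \<in> q"
      using q unfolding well_order_on_def linear_order_on_def total_on_def by blast
    then show "(a, b) \<in> ?r \<or> (b, a) \<in> ?r"
      using \<open>a \<noteq> b\<close> tot[OF F F, of a b] by (cases "letter_rank a = letter_rank b") auto
  qed
  moreover have "(b, a) \<in> ?r" if "b \<in> set (prong a n)" for a b n
    using letter_rank_prong[OF that] by auto
  ultimately show ?thesis by blast
qed

definition prec :: "letter rel" where
  "prec = (SOME r. wf r \<and> total r \<and> (\<forall>a b n. b \<in> set (prong a n) \<longrightarrow> (b, a) \<in> r))"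

lemma wf_prec: "wf prec"
  and total_prec: "total prec"
  and prong_prec: "b \<in> set (prong a n) \<Longrightarrow> (b, a) \<in> prec"
proof -
  have *: "wf prec \<and> total prec \<and> (\<forall>a b n. b \<in> set (prong a n) \<longrightarrow> (b, a) \<in> prec)"
    unfolding prec_def by (rule someI_ex) (rule letter_order_exists)
  show "wf prec" "total prec" using * by (rule conjunct1, rule conjunct1[OF conjunct2])
  show "(b, a) \<in> prec" if "b \<in> set (prong a n)"
    using conjunct2[OF conjunct2[OF *]] that by (elim allE impE)
qed

section \<open>The selected fans\<close>

function selected :: "letter \<Rightarrow> bool" where
  "selected a \<longleftrightarrow> fan a \<and> (\<forall>b. (b, a) \<in> prec \<longrightarrow> selected b \<longrightarrow> compat b a)"
  by pat_completeness auto
termination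
  by (relation prec) (auto simp: wf_prec)

declare selected.simps [simp del]

lemma selected_fan: "selected a \<Longrightarrow> fan a"
  by (subst (asm) selected.simps) simp

lemma selected_compat:
  assumes "selected a" "selected b" "a \<noteq> b"
  shows "compat a b"
proof -
  have sym: "compat a b" if ba: "compat b a"
    unfolding compat_def
  proof (intro impI allI)
    fix m n m' n'
    assume st: "stem a = stem b"
      and c: "comparable (tip a m) (tip b n) \<and> comparable (tip a m') (tip b n')"
    from c have "comparable (tip b n) (tip a m) \<and> comparable (tip b n') (tip a m')" by blast
    from ba[unfolded compat_def, rule_format, OF st[symmetric] this]
    have "n = n' \<and> m = m'" .
    then show "m = m' \<and> n = n'" by simp
  qed
  consider "(a, b) \<in> prec" | "(b, a) \<in> prec"
    using total_prec assms(3) by (auto simp: total_on_def)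
  then show ?thesis
    using assms sym selected.simps[of a] selected.simps[of b] by cases blast+
qed

lemma stem_less_tip: "fan a \<Longrightarrow> strict_prefix (stem a) (tip a n)"
  by (auto simp: fan_def tip_def intro: prefix_order.less_le_trans[of _ "prong a n"])

lemma dir_tip:
  assumes "fan a" shows "prefix (stem a @ [dir a n]) (tip a n)"
proof -
  obtain z zs where "tip a n = stem a @ z # zs"
    using stem_less_tip[OF assms, of n] by (elim strict_prefixE')
  then show ?thesis by (simp add: dir_def)
qed

lemma fan_dir_inj: "fan a \<Longrightarrow> dir a m = dir a n \<longleftrightarrow> m = n"
  by (auto simp: fan_def inj_def)

text \<open>A node that is not below the stem can only meet the tip in its own direction, since the tips
lie above distinct successors of the stem.\<close>

lemma comparable_tip_dir:
  assumes "fan a" "\<not> prefix u (stem a)" "comparable (tip a n) u"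
  shows "prefix (stem a @ [dir a n]) u"
proof -
  have p: "prefix (stem a @ [dir a n]) (tip a n)" by (rule dir_tip[OF assms(1)])
  from assms(3) show ?thesis
  proof
    assume "prefix (tip a n) u" then show ?thesis using p prefix_order.trans by blast
  next
    assume "prefix u (tip a n)"
    then have "comparable (stem a @ [dir a n]) u" using p prefix_same_cases by blast
    then show ?thesis using assms(2) by (auto simp: prefix_snoc)
  qed
qed

lemma comparable_tip_unique:
  assumes "fan a" "\<not> prefix u (stem a)" "comparable (tip a n) u" "comparable (tip a m) u"
  shows "m = n"
proof -
  have "prefix (stem a @ [dir a n]) u" "prefix (stem a @ [dir a m]) u"
    using comparable_tip_dir assms by blast+
  then have "dir a n = dir a m" by (auto simp: prefix_def)
  then show ?thesis using fan_dir_inj[OF assms(1)] by simp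
qed

lemma not_tip_prefix_stem: "fan a \<Longrightarrow> \<not> prefix (tip a n) (stem a)"
  using stem_less_tip[of a n] by (auto simp: strict_prefix_def)

lemma sparse_subsequence:
  fixes R :: "nat \<Rightarrow> nat \<Rightarrow> bool"
  assumes "\<And>n. finite {n'. R n n'}"
  shows "\<exists>\<sigma> :: nat \<Rightarrow> nat. strict_mono \<sigma> \<and> (\<forall>i j. i < j \<longrightarrow> \<not> R (\<sigma> i) (\<sigma> j))"
proof -
  let ?P = "\<lambda>(\<sigma> :: nat \<Rightarrow> nat) (j :: nat) r. \<forall>i<j. \<sigma> i < r \<and> \<not> R (\<sigma> i) r"
  have "\<exists>\<sigma>. \<forall>j. ?P \<sigma> j (\<sigma> j)"
  proof (rule dependent_wellorder_choice[where P = ?P])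
    fix j and \<sigma> :: "nat \<Rightarrow> nat"
    have "finite (\<Union>i<j. {..\<sigma> i} \<union> {n'. R (\<sigma> i) n'})" using assms by auto
    then obtain r where "r \<notin> (\<Union>i<j. {..\<sigma> i} \<union> {n'. R (\<sigma> i) n'})"
      using ex_new_if_finite infinite_UNIV_nat by blast
    then show "\<exists>r. ?P \<sigma> j r" by (intro exI[of _ r]) (auto simp: not_le)
  qed auto
  then show ?thesis by (auto simp: strict_mono_def)
qed

text \<open>Suppose no selected fan works.  Only the finitely many fans whose code occurs in \<open>v n\<close> have
a tip below \<open>v n\<close>, and each of them meets finitely many of the \<open>v n'\<close>; hence a subsequence exists on
which every selected fan with stem \<open>s\<close> has tips below at most one term.  The fan \<open>a\<close> built from that
subsequence is then compatible with every earlier selected fan \<open>b\<close>: no tip of \<open>b\<close> extends a tip of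
\<open>a\<close>, as \<open>b\<close> would mention \<open>a\<close> and come later.  So \<open>a\<close> itself is selected, a contradiction.\<close>

lemma selected_maximal:
  fixes v :: "nat \<Rightarrow> node"
  assumes s: "\<And>n. strict_prefix s (v n)" and i: "inj (\<lambda>n. v n ! length s)"
  shows "\<exists>a. selected a \<and> stem a = s \<and> infinite {n. \<exists>m. comparable (v n) (tip a m)}"
proof (rule ccontr)
  assume neg: "\<not> ?thesis"
  define R where "R n n' \<longleftrightarrow> (\<exists>b. selected b \<and> stem b = s \<and>
    (\<exists>m. prefix (tip b m) (v n)) \<and> (\<exists>m. prefix (tip b m) (v n')))" for n n'
  have "finite {n'. R n n'}" for n
  proof (rule finite_subset)
    show "{n'. R n n'} \<subseteq> (\<Union>b \<in> {b \<in> set (v n). selected b \<and> stem b = s}.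
        {n'. \<exists>m. comparable (v n') (tip b m)})"
    proof
      fix n' assume "n' \<in> {n'. R n n'}"
      then obtain b m m' where b: "selected b" "stem b = s" "prefix (tip b m) (v n)" "prefix (tip b m') (v n')"
        unfolding R_def by blast
      then have "b \<in> set (v n)" using set_mono_prefix[of "tip b m"] by (auto simp: tip_def)
      then show "n' \<in> (\<Union>b \<in> {b \<in> set (v n). selected b \<and> stem b = s}.
          {n'. \<exists>m. comparable (v n') (tip b m)})"
        using b by blast
    qed
    have "finite {n'. \<exists>m. comparable (v n') (tip b m)}" if "selected b" "stem b = s" for b
      using neg that by blast
    then show "finite (\<Union>b \<in> {b \<in> set (v n). selected b \<and> stem b = s}.
          {n'. \<exists>m. comparable (v n') (tip b m)})" by (intro finite_UN_I) auto
  qed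
  from sparse_subsequence[of R, OF this] obtain \<sigma> :: "nat \<Rightarrow> nat"
    where "strict_mono \<sigma> \<and> (\<forall>i j. i < j \<longrightarrow> \<not> R (\<sigma> i) (\<sigma> j))" ..
  then have \<sigma>: "strict_mono \<sigma>" "\<And>i j. i < j \<Longrightarrow> \<not> R (\<sigma> i) (\<sigma> j)" by auto
  define a where "a = Seq (case_nat s (v \<circ> \<sigma>))"
  have a [simp]: "stem a = s" "prong a n = v (\<sigma> n)" for n by (auto simp: a_def)
  have dira: "dir a n = v (\<sigma> n) ! length s" for n
    using s[of "\<sigma> n"] by (auto simp: dir_def tip_def nth_append dest: prefix_length_less)
  have fan: "fan a"
    unfolding fan_def
  proof (intro conjI allI injI)
    fix m n assume "dir a m = dir a n"
    then have "\<sigma> m = \<sigma> n" using injD[OF i] by (simp add: dira)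
    then show "m = n" using strict_mono_eq[OF \<sigma>(1)] by simp
  qed (use s in simp)
  have "compat b a" if ba: "(b, a) \<in> prec" and b: "selected b" for b
  proof -
    have below: "prefix (tip b m) (v (\<sigma> n))" if "comparable (tip b m) (tip a n)" for m n
    proof -
      have asym: "(a, b) \<notin> prec" by (rule wf_not_sym[OF wf_prec ba])
      then have "a \<noteq> b" using ba by blast
      moreover have "\<not> prefix (tip a n) (prong b m)"
      proof
        assume "prefix (tip a n) (prong b m)"
        then have "a \<in> set (prong b m)"
          using set_mono_prefix[of "tip a n" "prong b m"] by (simp add: tip_def)
        then show False using asym prong_prec by blast
      qed
      ultimately show ?thesis
        using that by (auto simp: tip_def)
    qed
    show ?thesis unfolding compat_def
    proof (intro impI allI)
      fix m n m' n'
      assume st: "stem b = stem a"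
        and c: "comparable (tip b m) (tip a n) \<and> comparable (tip b m') (tip a n')"
      have below': "prefix (tip b m) (v (\<sigma> n))" "prefix (tip b m') (v (\<sigma> n'))"
        using below c by auto
      show "m = m' \<and> n = n'"
      proof
        have no: "\<not> i < j" if "prefix (tip b p) (v (\<sigma> i))" "prefix (tip b p') (v (\<sigma> j))" for i j p p'
          using \<sigma>(2)[of i j] b st that unfolding R_def a(1) by blast
        show nn: "n = n'"
          using no[OF below'] no[OF below'(2,1)] by simp
        have "\<not> prefix (tip a n) (stem b)"
          using not_tip_prefix_stem[OF fan, of n] st by simp
        then show "m = m'"
          using comparable_tip_unique[OF selected_fan[OF b]] c nn by blast
      qed
    qed
  qed
  then have "selected a" using fan by (subst selected.simps) simp
  then have "finite {n. \<exists>m. comparable (v n) (tip a m)}" using neg a(1) by blast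
  moreover have "prefix (v (\<sigma> n)) (tip a n)" for n by (simp add: tip_def)
  then have "range \<sigma> \<subseteq> {n. \<exists>m. comparable (v n) (tip a m)}" by blast
  moreover have "infinite (range \<sigma>)"
    using \<sigma>(1) strict_mono_imp_inj_on range_inj_infinite by blast
  ultimately show False using finite_subset by blast
qed

text \<open>The improvement over \<open>selected_maximal\<close> is that the tips extend the given nodes, instead of being
merely comparable to them.  As \<open>S\<close> is uncountable, the directions can be picked
one after the other outside the countably many directions of the fans already mentioned; then
any fan has tips below at most one of the chosen nodes.  The freedom to
choose \<open>n\<close> lets the prescribed node change along the sequence of directions.\<close>

lemma selected_uncountable:
  fixes w :: "letter \<Rightarrow> nat \<Rightarrow> node"
  assumes S: "\<not> countable S" and w: "\<And>d n. d \<in> S \<Longrightarrow> prefix [d] (w d n)"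
  shows "\<exists>a. selected a \<and> stem a = [] \<and> (\<forall>k. \<exists>m\<ge>k. \<exists>n\<ge>k. \<exists>d\<in>S. prefix (w d n) (tip a m))"
proof -
  \<comment> \<open>directions forbidden after \<open>d\<close> has been chosen at step \<open>n\<close>\<close>
  define C where "C d n = insert d (\<Union>b\<in>set (w d n). range (dir b))" for d n
  have C: "countable (C d n)" for d n
    unfolding C_def by (auto simp: countable_finite)
  let ?P = "\<lambda>f j r. r \<in> S \<and> (\<forall>i<j. r \<notin> C (f i) i)"
  have "\<exists>f :: nat \<Rightarrow> letter. \<forall>j. ?P f j (f j)"
  proof (rule dependent_wellorder_choice)
    fix j :: nat and f
    have "countable (\<Union>i<j. C (f i) i)" using C by (auto simp: countable_finite)
    then obtain r where "r \<in> S" "r \<notin> (\<Union>i<j. C (f i) i)"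
      using S by (meson countable_subset subsetI)
    then show "\<exists>r. ?P f j r" by auto
  qed auto
  then obtain f :: "nat \<Rightarrow> letter" where "\<forall>j. f j \<in> S \<and> (\<forall>i<j. f j \<notin> C (f i) i)" ..
  then have fS: "f j \<in> S" and f: "i < j \<Longrightarrow> f j \<notin> C (f i) i" for i j
    by simp_all
  have "inj f"
  proof (rule linorder_injI)
    fix i j :: nat assume "i < j"
    then show "f i \<noteq> f j" using f[of i j] by (auto simp: C_def)
  qed
  define v where "v n = w (f n) n" for n
  have pv: "prefix [f n] (v n)" for n using w fS by (simp add: v_def)
  have hdv: "v n ! 0 = f n" "strict_prefix [] (v n)" for n
    using pv[of n] by (auto simp: prefix_def strict_prefix_def)
  obtain a where a: "selected a" "stem a = []" "infinite {n. \<exists>m. comparable (v n) (tip a m)}"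
    using selected_maximal[of "[]" v] hdv \<open>inj f\<close> by auto
  have fan: "fan a" using a selected_fan by blast
  have dir: "dir a m = f n" if "comparable (v n) (tip a m)" for m n
  proof -
    have "\<not> prefix (v n) (stem a)" using hdv[of n] a(2) by auto
    then have "prefix (stem a @ [dir a m]) (v n)"
      using comparable_tip_dir[OF fan] that by blast
    then show ?thesis using a(2) hdv(1)[of n] by (auto simp: prefix_def)
  qed
  let ?B = "{n. \<exists>m. prefix (tip a m) (v n)}"
  have B: "n' \<le> n" if nB: "n \<in> ?B" "n' \<in> ?B" for n n'
  proof (rule ccontr)
    assume "\<not> n' \<le> n"
    obtain m m' where m: "prefix (tip a m) (v n)" "prefix (tip a m') (v n')" using nB by auto
    have "a \<in> set (w (f n) n)" using set_mono_prefix[OF m(1)] by (auto simp: tip_def v_def)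
    moreover have "f n' = dir a m'" using dir[of n' m'] m(2) by simp
    ultimately have "f n' \<in> C (f n) n" by (auto simp: C_def)
    then show False using f \<open>\<not> n' \<le> n\<close> by auto
  qed
  have finB: "finite ?B"
  proof (cases "?B = {}")
    case False
    then obtain n where "n \<in> ?B" by blast
    then have "?B \<subseteq> {..n}" using B by blast
    then show ?thesis using finite_subset by blast
  qed simp
  have "\<exists>m\<ge>k. \<exists>n\<ge>k. \<exists>d\<in>S. prefix (w d n) (tip a m)" for k
  proof (rule ccontr)
    assume neg: "\<not> ?thesis"
    let ?N = "{n. \<exists>m. prefix (v n) (tip a m)} - {..<k}"
    have "{n. \<exists>m. comparable (v n) (tip a m)} \<subseteq> ?N \<union> {..<k} \<union> ?B" by auto
    then have "infinite ?N"
      using a(3) finB finite_subset[of _ "?N \<union> {..<k} \<union> ?B"] by blast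
    moreover have "f ` ?N \<subseteq> dir a ` {..<k}"
    proof
      fix d assume "d \<in> f ` ?N"
      then obtain n where "d = f n" "n \<in> ?N" by blast
      then obtain m where n: "d = f n" "prefix (v n) (tip a m)" "n \<ge> k"
        by (auto simp del: not_less simp: linorder_not_less)
      have "\<not> k \<le> m" using neg fS n(2,3) unfolding v_def by blast
      moreover have "d = dir a m" using dir[of n m] n(1,2) by simp
      ultimately show "d \<in> dir a ` {..<k}" by simp
    qed
    then have "finite (f ` ?N)" using finite_subset by blast
    ultimately show False
      using finite_imageD[of f ?N] inj_on_subset[OF \<open>inj f\<close>] by blast
  qed
  then show ?thesis using a by blast
qed

section \<open>Branches\<close>

definition initial :: "(nat \<Rightarrow> letter) \<Rightarrow> nat \<Rightarrow> node" where
  "initial x n = map x [0..<n]"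

definition below :: "node \<Rightarrow> (nat \<Rightarrow> letter) \<Rightarrow> bool" where
  "below u x \<longleftrightarrow> initial x (length u) = u"

lemma length_initial [simp]: "length (initial x n) = n"
  by (simp add: initial_def)

lemma below_initial [simp]: "below (initial x n) x"
  by (simp add: below_def)

lemma below_Nil [simp]: "below [] x"
  by (simp add: below_def initial_def)

lemma take_initial: "take m (initial x n) = initial x (min m n)"
  by (simp add: initial_def take_map min_def)

lemma below_nth: "below u x \<Longrightarrow> i < length u \<Longrightarrow> u ! i = x i"
  unfolding below_def initial_def by (metis add_0 length_map nth_map nth_upt length_upt diff_zero)

lemma below_prefix:
  assumes "below v x" "prefix u v" shows "below u x"
proof -
  have "u = take (length u) v" "length u \<le> length v"
    using assms(2) by (auto simp: prefix_def)
  then show ?thesis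
    using assms(1) take_initial[of "length u" x "length v"] by (simp add: below_def)
qed

lemma below_prefix_initial:
  assumes "below u x" "length u \<le> n" shows "prefix u (initial x n)"
proof -
  have "u = take (length u) (initial x n)"
    using assms by (simp add: take_initial below_def)
  then show ?thesis by (metis take_is_prefix)
qed

lemma below_prefixI:
  assumes "below u x" "below v x" "length u \<le> length v" shows "prefix u v"
  using below_prefix_initial[OF assms(1,3)] assms(2) by (simp add: below_def)

lemma below_comparable: "below u x \<Longrightarrow> below v x \<Longrightarrow> comparable u v"
  using below_prefixI nat_le_linear by blast

lemma below_exists: "\<exists>x. below u x"
  by (rule exI[of _ "\<lambda>i. if i < length u then u ! i else Seq (\<lambda>_. [])"])
    (auto simp: below_def initial_def intro!: nth_equalityI)

lemma branch_through:
  assumes "\<And>n. strict_prefix (u n) (u (Suc n))"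
  shows "\<exists>x. \<forall>n. below (u n) x"
proof -
  have mono: "prefix (u m) (u n)" if "m \<le> n" for m n
    using that
  proof (induction rule: dec_induct)
    case (step n)
    then show ?case using assms[of n] by (auto simp: strict_prefix_def intro: prefix_order.trans)
  qed simp
  have len: "n \<le> length (u n)" for n
  proof (induction n)
    case (Suc n)
    then show ?case using prefix_length_less[OF assms[of n]] by simp
  qed simp
  have "u n = initial (\<lambda>i. u (Suc i) ! i) (length (u n))" for n
  proof (rule nth_equalityI)
    fix i assume i: "i < length (u n)"
    have c: "comparable (u n) (u (Suc i))" using mono nat_le_linear by blast
    have "i < length (u (Suc i))" using len[of "Suc i"] by simp
    then show "u n ! i = initial (\<lambda>i. u (Suc i) ! i) (length (u n)) ! i"
      using i c by (auto simp: initial_def prefix_def nth_append)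
  qed simp
  then show ?thesis unfolding below_def by metis
qed

section \<open>The space\<close>

text \<open>Constant sequences of one-letter words and of two-letter words keep the two kinds of points apart.\<close>

definition br :: "(nat \<Rightarrow> letter) \<Rightarrow> real set" where
  "br x = encode (Seq (\<lambda>n. [x n]))"

definition pt :: "letter \<Rightarrow> real set" where
  "pt a = encode (Seq (\<lambda>_. [a, a]))"

lemma br_inject [simp]: "br x = br y \<longleftrightarrow> x = y"
  by (auto simp: br_def fun_eq_iff)

lemma pt_inject [simp]: "pt a = pt b \<longleftrightarrow> a = b"
  by (auto simp: pt_def fun_eq_iff)

lemma br_neq_pt [simp]: "br x \<noteq> pt a" "pt a \<noteq> br x"
  by (auto simp: br_def pt_def fun_eq_iff)

text \<open>A cylinder contains the fan points whose stem lies above the node; those with shorter stem have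
at most one tip comparable to the node, hence a neighbourhood missing the cylinder.\<close>

definition cyl :: "node \<Rightarrow> real set set" where
  "cyl u = br ` {x. below u x} \<union> pt ` {a. selected a \<and> prefix u (stem a)}"

lemma br_cyl [simp]: "br x \<in> cyl u \<longleftrightarrow> below u x"
  by (auto simp: cyl_def)

lemma pt_cyl [simp]: "pt a \<in> cyl u \<longleftrightarrow> selected a \<and> prefix u (stem a)"
  by (auto simp: cyl_def)

lemma cyl_cases:
  assumes "q \<in> cyl u"
  obtains x where "q = br x" "below u x" | a where "q = pt a" "selected a" "prefix u (stem a)"
  using assms by (auto simp: cyl_def)

lemma cyl_mono: "prefix u v \<Longrightarrow> cyl v \<subseteq> cyl u"
  by (auto elim!: cyl_cases intro: below_prefix prefix_order.trans)

lemma cyl_meet: "q \<in> cyl u \<Longrightarrow> q \<in> cyl v \<Longrightarrow> comparable u v"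
  by (auto elim!: cyl_cases dest: below_comparable prefix_same_cases)

lemma prefix_same_length: "prefix u v \<Longrightarrow> length u = length v \<Longrightarrow> u = v"
  by (auto simp: prefix_def)

lemma cyl_nonempty: "\<exists>x. br x \<in> cyl u"
  using below_exists by simp

definition nbhd :: "letter \<Rightarrow> nat \<Rightarrow> real set set" where
  "nbhd a k = insert (pt a) (\<Union>n\<in>{k..}. cyl (tip a n))"

lemma pt_nbhd [simp]: "pt a \<in> nbhd a k"
  by (simp add: nbhd_def)

lemma nbhd_antimono: "k \<le> l \<Longrightarrow> nbhd a l \<subseteq> nbhd a k"
  by (auto simp: nbhd_def)

lemma tip_subset_nbhd: "k \<le> n \<Longrightarrow> cyl (tip a n) \<subseteq> nbhd a k"
  by (auto simp: nbhd_def)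

lemma nbhd_subset_cyl:
  assumes "selected a" "prefix u (stem a)" shows "nbhd a k \<subseteq> cyl u"
proof -
  have "prefix u (tip a n)" for n
    using assms(2) stem_less_tip[OF selected_fan[OF assms(1)], of n]
    by (auto simp: strict_prefix_def intro: prefix_order.trans)
  then have "cyl (tip a n) \<subseteq> cyl u" for n by (rule cyl_mono)
  then show ?thesis using assms by (auto simp: nbhd_def)
qed

lemma pt_in_nbhd_same_stem:
  assumes "selected a" "stem a = stem b" shows "pt b \<in> nbhd a k \<longleftrightarrow> b = a"
  using not_tip_prefix_stem[OF selected_fan[OF assms(1)]] assms(2) by (auto simp: nbhd_def)

definition fan_open :: "real set set \<Rightarrow> bool" where
  "fan_open U \<longleftrightarrow> U \<subseteq> cyl [] \<and> (\<forall>x. br x \<in> U \<longrightarrow> (\<exists>n. cyl (initial x n) \<subseteq> U)) \<and>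
     (\<forall>a. pt a \<in> U \<longrightarrow> (\<exists>k. nbhd a k \<subseteq> U))"

definition fanspace :: "real set topology" where
  "fanspace = topology fan_open"

lemma fan_open_br: "fan_open U \<Longrightarrow> br x \<in> U \<Longrightarrow> \<exists>n. cyl (initial x n) \<subseteq> U"
  by (simp add: fan_open_def)

lemma fan_open_pt: "fan_open U \<Longrightarrow> pt a \<in> U \<Longrightarrow> \<exists>k. nbhd a k \<subseteq> U"
  by (simp add: fan_open_def)

lemma istopology_fan_open: "istopology fan_open"
  unfolding istopology_def
proof (intro conjI allI impI)
  fix U V assume U: "fan_open U" and V: "fan_open V"
  show "fan_open (U \<inter> V)"
    unfolding fan_open_def
  proof (intro conjI allI impI)
    fix x assume "br x \<in> U \<inter> V"
    then obtain m n where "cyl (initial x m) \<subseteq> U" "cyl (initial x n) \<subseteq> V"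
      using fan_open_br[OF U, of x] fan_open_br[OF V, of x] by blast
    moreover have "cyl (initial x (max m n)) \<subseteq> cyl (initial x m)" "cyl (initial x (max m n)) \<subseteq> cyl (initial x n)"
      by (auto intro!: cyl_mono below_prefix_initial)
    ultimately show "\<exists>n. cyl (initial x n) \<subseteq> U \<inter> V" by blast
  next
    fix a assume "pt a \<in> U \<inter> V"
    then obtain m n where "nbhd a m \<subseteq> U" "nbhd a n \<subseteq> V"
      using fan_open_pt[OF U, of a] fan_open_pt[OF V, of a] by blast
    moreover have "nbhd a (max m n) \<subseteq> nbhd a m" "nbhd a (max m n) \<subseteq> nbhd a n"
      by (auto intro!: nbhd_antimono)
    ultimately show "\<exists>k. nbhd a k \<subseteq> U \<inter> V" by blast
  next
    show "U \<inter> V \<subseteq> cyl []" using U unfolding fan_open_def by (elim conjE) (rule le_infI1)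
  qed
next
  fix \<K> assume K: "\<forall>K\<in>\<K>. fan_open K"
  show "fan_open (\<Union>\<K>)"
    unfolding fan_open_def
  proof (intro conjI allI impI)
    have "U \<subseteq> cyl []" if "U \<in> \<K>" for U using K that by (simp add: fan_open_def)
    then show "\<Union>\<K> \<subseteq> cyl []" by blast
  next
    fix x assume "br x \<in> \<Union>\<K>"
    then obtain U where U: "U \<in> \<K>" "br x \<in> U" by blast
    then obtain n where "cyl (initial x n) \<subseteq> U" using K fan_open_br by blast
    then show "\<exists>n. cyl (initial x n) \<subseteq> \<Union>\<K>" using U(1) by blast
  next
    fix a assume "pt a \<in> \<Union>\<K>"
    then obtain U where U: "U \<in> \<K>" "pt a \<in> U" by blast
    then obtain n where "nbhd a n \<subseteq> U" using K fan_open_pt by blast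
    then show "\<exists>n. nbhd a n \<subseteq> \<Union>\<K>" using U(1) by blast
  qed
qed

lemma openin_fanspace: "openin fanspace = fan_open"
  unfolding fanspace_def by (rule topology_inverse'[OF istopology_fan_open])

lemma openin_cyl: "openin fanspace (cyl u)"
  unfolding openin_fanspace fan_open_def
proof (intro conjI allI impI)
  show "cyl u \<subseteq> cyl []" by (rule cyl_mono) simp
  show "\<exists>n. cyl (initial x n) \<subseteq> cyl u" if "br x \<in> cyl u" for x
    using that by (intro exI[of _ "length u"]) (simp add: below_def)
  show "\<exists>k. nbhd a k \<subseteq> cyl u" if "pt a \<in> cyl u" for a
    using that nbhd_subset_cyl by auto
qed

lemma topspace_fanspace: "topspace fanspace = cyl []"
proof
  have "fan_open (topspace fanspace)"
    using openin_topspace[of fanspace] by (simp add: openin_fanspace)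
  then show "topspace fanspace \<subseteq> cyl []" by (simp add: fan_open_def)
  show "cyl [] \<subseteq> topspace fanspace" by (rule openin_subset[OF openin_cyl])
qed

lemma openin_nbhd: "selected a \<Longrightarrow> openin fanspace (nbhd a k)"
  unfolding openin_fanspace fan_open_def
proof (intro conjI allI impI)
  assume a: "selected a"
  show "nbhd a k \<subseteq> cyl []" by (rule nbhd_subset_cyl[OF a]) simp
  show "\<exists>n. cyl (initial x n) \<subseteq> nbhd a k" if x: "br x \<in> nbhd a k" for x
  proof -
    obtain n where "n \<ge> k" "below (tip a n) x"
      using x by (auto simp: nbhd_def)
    then show ?thesis
      using tip_subset_nbhd[of k n a] by (intro exI[of _ "length (tip a n)"]) (simp add: below_def)
  qed
  show "\<exists>j. nbhd b j \<subseteq> nbhd a k" if b: "pt b \<in> nbhd a k" for b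
  proof (cases "b = a")
    case False
    then obtain n where "n \<ge> k" "selected b" "prefix (tip a n) (stem b)"
      using b by (auto simp: nbhd_def)
    then show ?thesis
      using tip_subset_nbhd[of k n a] nbhd_subset_cyl[of b "tip a n" 0] by blast
  qed auto
qed

lemma openin_fanspace_iff:
  "openin fanspace U \<longleftrightarrow> U \<subseteq> cyl [] \<and> (\<forall>x. br x \<in> U \<longrightarrow> (\<exists>n. cyl (initial x n) \<subseteq> U)) \<and>
     (\<forall>a. pt a \<in> U \<longrightarrow> (\<exists>k. nbhd a k \<subseteq> U))"
  by (simp add: openin_fanspace fan_open_def)

lemma openin_br: "openin fanspace U \<Longrightarrow> br x \<in> U \<Longrightarrow> \<exists>n. cyl (initial x n) \<subseteq> U"
  by (simp add: openin_fanspace fan_open_def)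

lemma openin_pt: "openin fanspace U \<Longrightarrow> pt a \<in> U \<Longrightarrow> \<exists>k. nbhd a k \<subseteq> U"
  by (simp add: openin_fanspace fan_open_def)

lemma openin_contains_cyl:
  assumes "openin fanspace U" "q \<in> U"
  shows "\<exists>u. cyl u \<subseteq> U"
proof -
  have "q \<in> cyl []" using openin_subset[OF assms(1)] assms(2) topspace_fanspace by auto
  then show ?thesis
  proof (cases rule: cyl_cases)
    case (1 x)
    then show ?thesis using openin_br assms by blast
  next
    case (2 a)
    then obtain k where "nbhd a k \<subseteq> U" using openin_pt assms by blast
    then show ?thesis using tip_subset_nbhd[of k k a] by blast
  qed
qed

section \<open>The basic sets are clopen\<close>

lemma nbhd_misses_cyl:
  assumes a: "selected a" and u: "\<not> prefix u (stem a)"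
  shows "\<exists>k. nbhd a k \<inter> cyl u = {}"
proof -
  have "\<exists>k. \<forall>n\<ge>k. \<not> comparable (tip a n) u"
  proof (cases "\<exists>n. comparable (tip a n) u")
    case True
    then obtain m where m: "comparable (tip a m) u" ..
    have "n \<noteq> m" if "n \<ge> Suc m" for n using that by simp
    then show ?thesis
      using comparable_tip_unique[OF selected_fan[OF a] u m] by blast
  qed blast
  then obtain k where "\<forall>n\<ge>k. \<not> comparable (tip a n) u" ..
  then have "nbhd a k \<inter> cyl u = {}"
    using u cyl_meet unfolding nbhd_def by fastforce
  then show ?thesis ..
qed

lemma closedin_cyl: "closedin fanspace (cyl u)"
  unfolding closedin_def topspace_fanspace openin_fanspace_iff
proof (intro conjI allI impI)
  show "cyl u \<subseteq> cyl []" by (rule cyl_mono) simp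
next
  fix x assume x: "br x \<in> cyl [] - cyl u"
  have "cyl (initial x (length u)) \<inter> cyl u = {}"
  proof (rule ccontr)
    assume "\<not> ?thesis"
    then have "comparable (initial x (length u)) u" using cyl_meet by blast
    then have "initial x (length u) = u" by (auto dest: prefix_same_length)
    then show False using x by (simp add: below_def)
  qed
  moreover have "cyl (initial x (length u)) \<subseteq> cyl []" by (rule cyl_mono) simp
  ultimately show "\<exists>n. cyl (initial x n) \<subseteq> cyl [] - cyl u" by blast
next
  fix a assume "pt a \<in> cyl [] - cyl u"
  then have a: "selected a" "\<not> prefix u (stem a)" by auto
  then obtain k where "nbhd a k \<inter> cyl u = {}" using nbhd_misses_cyl by blast
  moreover have "nbhd a k \<subseteq> cyl []" by (rule nbhd_subset_cyl[OF a(1)]) simp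
  ultimately show "\<exists>k. nbhd a k \<subseteq> cyl [] - cyl u" by blast
qed blast

text \<open>Inside \<open>cyl u\<close> the neighbourhood \<open>nbhd a k\<close> reduces to a single clopen cylinder, or to nothing.\<close>

lemma separated_from_nbhd:
  assumes a: "selected a" and q: "q \<in> cyl u" "q \<notin> nbhd a k" and u: "\<not> prefix u (stem a)"
  shows "\<exists>T. openin fanspace T \<and> q \<in> T \<and> T \<inter> nbhd a k = {}"
proof (cases "\<exists>n\<ge>k. comparable (tip a n) u")
  case True
  then obtain m where m: "m \<ge> k" "comparable (tip a m) u" by blast
  let ?T = "cyl u - cyl (tip a m)"
  have "openin fanspace ?T" by (rule openin_diff[OF openin_cyl closedin_cyl])
  moreover have "q \<in> ?T" using q tip_subset_nbhd[OF m(1)] by blast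
  moreover have "?T \<inter> nbhd a k = {}"
  proof (rule ccontr)
    assume "\<not> ?thesis"
    then obtain p where p: "p \<in> cyl u" "p \<notin> cyl (tip a m)" "p \<in> nbhd a k" by blast
    have "p \<noteq> pt a" using p(1) u by auto
    then obtain n where n: "p \<in> cyl (tip a n)" using p(3) by (auto simp: nbhd_def)
    then have "comparable (tip a n) u" using p(1) cyl_meet by blast
    then have "n = m" using comparable_tip_unique[OF selected_fan[OF a] u] m(2) by blast
    then show False using n p(2) by simp
  qed
  ultimately show ?thesis by blast
next
  case False
  have "cyl u \<inter> nbhd a k = {}"
    using False u cyl_meet unfolding nbhd_def by fastforce
  then show ?thesis using q(1) openin_cyl by blast
qed

lemma separated_same_stem:
  assumes a: "selected a" and b: "selected b" and st: "stem b = stem a" and ne: "b \<noteq> a"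
  shows "\<exists>j. nbhd b j \<inter> nbhd a k = {}"
proof -
  have c: "compat b a" using selected_compat[OF b a ne] .
  have "\<exists>j. \<forall>m\<ge>j. \<forall>n. \<not> comparable (tip b m) (tip a n)"
  proof (cases "\<exists>m n. comparable (tip b m) (tip a n)")
    case True
    then obtain m n where mn: "comparable (tip b m) (tip a n)" by blast
    have "m' = m" if "comparable (tip b m') (tip a n')" for m' n'
      using c st mn that unfolding compat_def by blast
    then show ?thesis by (metis Suc_n_not_le_n)
  qed blast
  then obtain j where j: "\<forall>m\<ge>j. \<forall>n. \<not> comparable (tip b m) (tip a n)" ..
  have "nbhd b j \<inter> nbhd a k = {}"
  proof (rule ccontr)
    assume "\<not> ?thesis"
    then obtain p where p: "p \<in> nbhd b j" "p \<in> nbhd a k" by blast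
    have "p \<noteq> pt a" "p \<noteq> pt b"
      using p pt_in_nbhd_same_stem[of a b] pt_in_nbhd_same_stem[of b a] a b st ne by auto
    then obtain m n where "m \<ge> j" "p \<in> cyl (tip b m)" "p \<in> cyl (tip a n)"
      using p by (auto simp: nbhd_def)
    then show False using j cyl_meet by blast
  qed
  then show ?thesis ..
qed

text \<open>A branch, and a fan point whose stem is not below the stem of \<open>a\<close>, lies in a cylinder where
\<open>nbhd a k\<close> is trivial.  A fan point with a stem strictly below can avoid the whole cylinder
over the stem of \<open>a\<close>.  For equal stems, compatibility of the selected fans is needed.\<close>

lemma closedin_nbhd:
  assumes a: "selected a" shows "closedin fanspace (nbhd a k)"
proof -
  have sub: "nbhd a k \<subseteq> topspace fanspace"
    using openin_nbhd[OF a] openin_subset by blast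
  have sep: "\<exists>T. openin fanspace T \<and> q \<in> T \<and> T \<inter> nbhd a k = {}"
    if q: "q \<in> cyl []" "q \<notin> nbhd a k" for q
    using q(1)
  proof (cases rule: cyl_cases)
    case (1 x)
    have "\<not> prefix (initial x (Suc (length (stem a)))) (stem a)"
      by (auto dest: prefix_length_le)
    then show ?thesis
      using separated_from_nbhd[OF a _ q(2), of "initial x (Suc (length (stem a)))"] 1 by simp
  next
    case (2 b)
    consider "\<not> prefix (stem b) (stem a)" | "stem b = stem a" | "\<not> prefix (stem a) (stem b)"
      using prefix_order.antisym by blast
    then show ?thesis
    proof cases
      case 1
      then show ?thesis using separated_from_nbhd[OF a _ q(2), of "stem b"] 2 by simp
    next
      case eq: 2
      have "b \<noteq> a" using q 2 by auto
      then obtain j where "nbhd b j \<inter> nbhd a k = {}"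
        using separated_same_stem[OF a] 2 eq by blast
      then show ?thesis
        using openin_nbhd[OF 2(2), of j] 2(1) by (intro exI[of _ "nbhd b j"]) simp
    next
      case 3
      then obtain j where "nbhd b j \<inter> cyl (stem a) = {}"
        using nbhd_misses_cyl 2 by blast
      then have "nbhd b j \<inter> nbhd a k = {}" using nbhd_subset_cyl[OF a, of "stem a" k] by auto
      then show ?thesis
        using openin_nbhd[OF 2(2), of j] 2(1) by (intro exI[of _ "nbhd b j"]) simp
    qed
  qed
  have "openin fanspace (topspace fanspace - nbhd a k)"
  proof (subst openin_subopen, intro ballI)
    fix q assume "q \<in> topspace fanspace - nbhd a k"
    then obtain T where "openin fanspace T" "q \<in> T" "T \<inter> nbhd a k = {}"
      using sep[of q] unfolding topspace_fanspace by blast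
    then show "\<exists>T. openin fanspace T \<and> q \<in> T \<and> T \<subseteq> topspace fanspace - nbhd a k"
      using openin_subset by blast
  qed
  then show ?thesis using sub by (simp add: closedin_def)
qed

section \<open>The Tychonoff property\<close>

definition fanbase :: "real set set set" where
  "fanbase = range cyl \<union> {nbhd a k | a k. selected a}"

lemma fanbase_clopen: "B \<in> fanbase \<Longrightarrow> openin fanspace B \<and> closedin fanspace B"
  by (auto simp: fanbase_def openin_cyl closedin_cyl openin_nbhd closedin_nbhd)

lemma fanbase_refines:
  assumes "openin fanspace U" "q \<in> U"
  shows "\<exists>B\<in>fanbase. q \<in> B \<and> B \<subseteq> U"
proof -
  have "q \<in> cyl []" using openin_subset[OF assms(1)] assms(2) topspace_fanspace by auto
  then show ?thesis
  proof (cases rule: cyl_cases)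
    case (1 x)
    then obtain n where "cyl (initial x n) \<subseteq> U" using openin_br assms by blast
    then show ?thesis using 1 by (intro bexI[of _ "cyl (initial x n)"]) (auto simp: fanbase_def)
  next
    case (2 a)
    then obtain k where "nbhd a k \<subseteq> U" using openin_pt assms by blast
    then show ?thesis using 2 by (intro bexI[of _ "nbhd a k"]) (auto simp: fanbase_def)
  qed
qed

lemma base_for_fanbase: "base_for fanspace fanbase"
  unfolding base_for_def openin_topology_base_unique
proof (intro conjI allI impI)
  show "openin fanspace V" if "V \<in> fanbase" for V
    using fanbase_clopen that by blast
  show "\<exists>V. V \<in> fanbase \<and> q \<in> V \<and> V \<subseteq> U" if "openin fanspace U \<and> q \<in> U" for U q
    using fanbase_refines that by blast
qed

lemma tips_meet:
  assumes "selected a" "q \<in> cyl (tip a m)" "q \<in> cyl (tip a n)"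
  shows "m = n"
  using comparable_tip_unique[OF selected_fan not_tip_prefix_stem[OF selected_fan]] cyl_meet assms
  by blast

lemma nbhd_index_bound:
  assumes "selected a" "q \<noteq> pt a"
  shows "\<exists>N. \<forall>k. q \<in> nbhd a k \<longrightarrow> k \<le> N"
proof (cases "\<exists>n. q \<in> cyl (tip a n)")
  case True
  then obtain n where n: "q \<in> cyl (tip a n)" ..
  have "k \<le> n" if k: "q \<in> nbhd a k" for k
  proof -
    obtain m where "m \<ge> k" "q \<in> cyl (tip a m)" using k assms(2) by (auto simp: nbhd_def)
    then show ?thesis using tips_meet[OF assms(1) n] by simp
  qed
  then show ?thesis by blast
next
  case False
  then have "\<not> q \<in> nbhd a k" for k using assms(2) by (simp add: nbhd_def)
  then show ?thesis by blast
qed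

lemma t1_fanspace: "t1_space fanspace"
  unfolding t1_space_def
proof (intro ballI impI)
  fix p q assume p: "p \<in> topspace fanspace" and q: "q \<in> topspace fanspace" and ne: "p \<noteq> q"
  from p show "\<exists>U. openin fanspace U \<and> p \<in> U \<and> q \<notin> U"
    unfolding topspace_fanspace
  proof (cases rule: cyl_cases)
    case (1 x)
    from q have "\<exists>n. q \<notin> cyl (initial x n)"
      unfolding topspace_fanspace
    proof (cases rule: cyl_cases)
      case y: (1 y)
      then have "x \<noteq> y" using 1 ne by simp
      then obtain i where "x i \<noteq> y i" by (auto simp: fun_eq_iff)
      moreover have "initial x (Suc i) ! i = x i" by (rule below_nth[OF below_initial]) simp
      ultimately have "\<not> below (initial x (Suc i)) y"
        using below_nth[of "initial x (Suc i)" y i] by auto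
      then show ?thesis using y by auto
    next
      case (2 a)
      have "\<not> prefix (initial x (Suc (length (stem a)))) (stem a)"
        by (auto dest: prefix_length_le)
      then show ?thesis using 2 by auto
    qed
    then obtain n where "q \<notin> cyl (initial x n)" ..
    then show ?thesis using 1 openin_cyl[of "initial x n"] by (intro exI[of _ "cyl (initial x n)"]) simp
  next
    case (2 a)
    then obtain N where N: "\<forall>k. q \<in> nbhd a k \<longrightarrow> k \<le> N"
      using nbhd_index_bound[of a q] ne by blast
    have "q \<notin> nbhd a (Suc N)" using N Suc_n_not_le_n by blast
    then show ?thesis
      using 2 openin_nbhd[of a "Suc N"] by (intro exI[of _ "nbhd a (Suc N)"]) simp
  qed
qed

lemma clopen_indicator_continuous:
  assumes "openin X B" "closedin X B"
  shows "continuous_map X (top_of_set {0..1::real}) (\<lambda>q. if q \<in> B then 0 else 1)"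
proof -
  have "continuous_map X euclideanreal (\<lambda>q. if q \<in> B then 0 else 1)"
    unfolding continuous_map
  proof (intro conjI allI impI)
    fix V :: "real set"
    have B: "B \<subseteq> topspace X" by (rule openin_subset[OF assms(1)])
    have "{q \<in> topspace X. (if q \<in> B then 0 else 1) \<in> V} =
      (if 0 \<in> V then B else {}) \<union> (if 1 \<in> V then topspace X - B else {})"
      using B by auto
    moreover have "openin X (topspace X - B)" using assms(2) by (simp add: closedin_def)
    ultimately show "openin X {q \<in> topspace X. (if q \<in> B then 0 else 1) \<in> V}"
      using assms(1) by (auto intro!: openin_Un simp del: Un_Diff_cancel)
  qed auto
  then show ?thesis by (auto simp: continuous_map_in_subtopology)
qed

lemma completely_regular_fanspace: "completely_regular_space fanspace"
  unfolding completely_regular_space_def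
proof (intro allI impI)
  fix S q assume Sq: "closedin fanspace S \<and> q \<in> topspace fanspace - S"
  then have "openin fanspace (topspace fanspace - S)" by (simp add: closedin_def)
  then obtain B where B: "B \<in> fanbase" "q \<in> B" "B \<subseteq> topspace fanspace - S"
    using fanbase_refines Sq by blast
  show "\<exists>f::real set \<Rightarrow> real. continuous_map fanspace (top_of_set {0..1}) f \<and> f q = 0 \<and> f ` S \<subseteq> {1}"
  proof (intro exI conjI)
    show "continuous_map fanspace (top_of_set {0..1::real}) (\<lambda>q. if q \<in> B then 0 else 1)"
      using clopen_indicator_continuous fanbase_clopen[OF B(1)] by blast
  qed (use B in auto)
qed

lemma tychonoff_fanspace: "tychonoff_space fanspace"
  by (simp add: tychonoff_space_def t1_fanspace completely_regular_fanspace)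

section \<open>Pseudocompactness\<close>

lemma comparable_meet:
  assumes "comparable u v" shows "cyl u \<inter> cyl v \<noteq> {}"
  using assms cyl_mono[of u v] cyl_mono[of v u] cyl_nonempty[of u] cyl_nonempty[of v] by blast

lemma fans_accumulate:
  fixes v :: "nat \<Rightarrow> node"
  assumes s: "\<And>n. strict_prefix s (v n)" and i: "inj (\<lambda>n. v n ! length s)"
  shows "\<exists>q\<in>topspace fanspace. \<forall>U. openin fanspace U \<and> q \<in> U \<longrightarrow> infinite {n. U \<inter> cyl (v n) \<noteq> {}}"
proof -
  obtain a where a: "selected a" "stem a = s" and inf: "infinite {n. \<exists>m. comparable (v n) (tip a m)}"
    using selected_maximal[of s v, OF s i] by blast
  have dir: "dir a m = v n ! length s" if c: "comparable (v n) (tip a m)" for m n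
  proof -
    have "\<not> prefix (v n) (stem a)" using s[of n] a(2) by (auto simp: strict_prefix_def)
    then have "prefix (stem a @ [dir a m]) (v n)"
      using comparable_tip_dir[OF selected_fan[OF a(1)]] c by blast
    then show ?thesis using a(2) by (auto simp: prefix_def)
  qed
  have "infinite {n. U \<inter> cyl (v n) \<noteq> {}}" if U: "openin fanspace U" "pt a \<in> U" for U
  proof
    assume fin: "finite {n. U \<inter> cyl (v n) \<noteq> {}}"
    obtain k where k: "nbhd a k \<subseteq> U" using openin_pt[OF U] ..
    let ?L = "{n. v n ! length s \<in> dir a ` {..<k}}"
    have "finite ?L"
      using finite_vimageI[OF _ i, of "dir a ` {..<k}"] by (simp add: vimage_def)
    moreover have "{n. \<exists>m. comparable (v n) (tip a m)} \<subseteq> {n. U \<inter> cyl (v n) \<noteq> {}} \<union> ?L"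
    proof
      fix n assume "n \<in> {n. \<exists>m. comparable (v n) (tip a m)}"
      then obtain m where m: "comparable (v n) (tip a m)" by blast
      show "n \<in> {n. U \<inter> cyl (v n) \<noteq> {}} \<union> ?L"
      proof (cases "k \<le> m")
        case True
        then have "cyl (tip a m) \<subseteq> U" using tip_subset_nbhd k by blast
        then show ?thesis using comparable_meet[OF m] by blast
      next
        case False
        then have "dir a m \<in> dir a ` {..<k}" by simp
        then have "v n ! length s \<in> dir a ` {..<k}" by (simp only: dir[OF m])
        then show ?thesis by blast
      qed
    qed
    ultimately show False using inf fin finite_subset by blast
  qed
  moreover have "pt a \<in> topspace fanspace" using a(1) by (simp add: topspace_fanspace)
  ultimately show ?thesis by blast
qed

text \<open>Call a node \<open>s\<close> heavy if it lies below infinitely many terms.  If some heavy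
node has no heavy immediate successor, then either it is repeated infinitely often, or a subsequence takes
distinct directions above it and a fan point is an accumulation point.  If every heavy node
has a heavy immediate successor, these lead to a branch at which the sequence accumulates.\<close>

lemma nodes_accumulate:
  fixes u :: "nat \<Rightarrow> node"
  shows "\<exists>q\<in>topspace fanspace. \<forall>U. openin fanspace U \<and> q \<in> U \<longrightarrow> infinite {n. U \<inter> cyl (u n) \<noteq> {}}"
proof -
  define I where "I s = {n. prefix s (u n)}" for s
  show ?thesis
  proof (cases "\<exists>s. infinite (I s) \<and> (\<forall>d. finite (I (s @ [d])))")
    case True
    then obtain s where s: "infinite (I s)" "\<And>d. finite (I (s @ [d]))" by blast
    show ?thesis
    proof (cases "finite {n. u n = s}")
      case False
      obtain x where x: "br x \<in> cyl s" using cyl_nonempty by blast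
      have "infinite {n. U \<inter> cyl (u n) \<noteq> {}}" if "openin fanspace U" "br x \<in> U" for U
      proof -
        have "{n. u n = s} \<subseteq> {n. U \<inter> cyl (u n) \<noteq> {}}" using x that by blast
        then show ?thesis using False finite_subset by blast
      qed
      moreover have "br x \<in> topspace fanspace" by (simp add: topspace_fanspace)
      ultimately show ?thesis by blast
    next
      case fin: True
      define J where "J = {n. strict_prefix s (u n)}"
      have "I s \<subseteq> {n. u n = s} \<union> J" by (auto simp: I_def J_def strict_prefix_def)
      then have J: "infinite J" using s(1) fin by (metis finite_Un finite_subset)
      define e where "e = enumerate J"
      have e: "strict_mono e" "\<And>i. e i \<in> J"
        using J by (auto simp: e_def strict_mono_enumerate enumerate_in_set)
      define R where "R i j \<longleftrightarrow> u (e i) ! length s = u (e j) ! length s" for i j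
      have "finite {j. R i j}" for i
      proof -
        have "prefix (s @ [u (e j) ! length s]) (u (e j))" for j
          using e(2)[of j] by (auto simp: J_def elim: strict_prefixE')
        then have "{j. R i j} \<subseteq> e -` I (s @ [u (e i) ! length s])"
          by (auto simp: R_def I_def)
        moreover have "finite (e -` I (s @ [u (e i) ! length s]))"
          using finite_vimageI[OF s(2) strict_mono_imp_inj_on[OF e(1)]] .
        ultimately show ?thesis using finite_subset by blast
      qed
      from sparse_subsequence[of R, OF this] obtain \<sigma> :: "nat \<Rightarrow> nat"
        where \<sigma>: "strict_mono \<sigma> \<and> (\<forall>i j. i < j \<longrightarrow> \<not> R (\<sigma> i) (\<sigma> j))" ..
      define v where "v n = u (e (\<sigma> n))" for n
      have "strict_prefix s (v n)" for n using e(2) by (simp add: v_def J_def)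
      moreover have "inj (\<lambda>n. v n ! length s)"
      proof (rule linorder_injI)
        fix i j :: nat assume "i < j"
        then show "v i ! length s \<noteq> v j ! length s" using \<sigma> by (simp add: v_def R_def)
      qed
      ultimately obtain q where q: "q \<in> topspace fanspace"
        "\<forall>U. openin fanspace U \<and> q \<in> U \<longrightarrow> infinite {n. U \<inter> cyl (v n) \<noteq> {}}"
        using fans_accumulate[of s v] by blast
      have "infinite {n. U \<inter> cyl (u n) \<noteq> {}}" if "openin fanspace U" "q \<in> U" for U
      proof
        assume "finite {n. U \<inter> cyl (u n) \<noteq> {}}"
        moreover have "inj (e \<circ> \<sigma>)"
          using e(1) \<sigma> by (simp add: inj_compose strict_mono_imp_inj_on)
        ultimately have "finite ((e \<circ> \<sigma>) -` {n. U \<inter> cyl (u n) \<noteq> {}})"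
          by (rule finite_vimageI)
        then show False using q(2) that by (simp add: vimage_def v_def)
      qed
      then show ?thesis using q(1) by blast
    qed
  next
    case False
    have "\<exists>S. \<forall>n. (length (S n) = n \<and> infinite (I (S n))) \<and> (\<exists>d. S (Suc n) = S n @ [d])"
    proof (rule dependent_nat_choice)
      show "\<exists>s. length s = 0 \<and> infinite (I s)" by (simp add: I_def)
      fix s n assume s: "length s = n \<and> infinite (I s)"
      then obtain d where "infinite (I (s @ [d]))" using False by blast
      then show "\<exists>t. (length t = Suc n \<and> infinite (I t)) \<and> (\<exists>d. t = s @ [d])"
        using s by (intro exI[of _ "s @ [d]"]) simp
    qed
    then obtain S where S: "\<And>n. length (S n) = n" "\<And>n. infinite (I (S n))" "\<And>n. \<exists>d. S (Suc n) = S n @ [d]"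
      by blast
    have "strict_prefix (S n) (S (Suc n))" for n
      using S(3)[of n] by (auto simp: strict_prefix_def)
    then obtain x where x: "\<And>n. below (S n) x" using branch_through[of S] by blast
    have "infinite {m. U \<inter> cyl (u m) \<noteq> {}}" if U: "openin fanspace U" "br x \<in> U" for U
    proof -
      obtain n where "cyl (initial x n) \<subseteq> U" using openin_br[OF U] ..
      moreover have "initial x n = S n" using x[of n] S(1)[of n] by (simp add: below_def)
      ultimately have "cyl (u m) \<subseteq> U" if "m \<in> I (S n)" for m
        using that cyl_mono[of "S n" "u m"] by (auto simp: I_def)
      then have "I (S n) \<subseteq> {m. U \<inter> cyl (u m) \<noteq> {}}" using cyl_nonempty by blast
      then show ?thesis using S(2) finite_subset by blast
    qed
    moreover have "br x \<in> topspace fanspace" by (simp add: topspace_fanspace)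
    ultimately show ?thesis by blast
  qed
qed

lemma pseudocompact_fanspace: "pseudocompact_space fanspace"
  unfolding pseudocompact_space_def
proof (intro allI impI)
  fix f assume f: "continuous_map fanspace euclideanreal f"
  show "bounded (f ` topspace fanspace)"
  proof (rule ccontr)
    assume unb: "\<not> bounded (f ` topspace fanspace)"
    have pre: "openin fanspace {q \<in> topspace fanspace. f q \<in> V}" if "open V" for V
      using openin_continuous_map_preimage[OF f] that by simp
    have "\<exists>u. cyl u \<subseteq> {q \<in> topspace fanspace. f q \<in> {y. real n < \<bar>y\<bar>}}" for n
    proof -
      obtain q where "q \<in> topspace fanspace" "\<not> \<bar>f q\<bar> \<le> real n"
        using unb unfolding bounded_iff by auto
      moreover have "open {y::real. real n < \<bar>y\<bar>}" by (intro open_Collect_less continuous_intros)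
      ultimately show ?thesis using openin_contains_cyl[OF pre, of "{y. real n < \<bar>y\<bar>}" q] by auto
    qed
    then obtain u where u: "\<And>n. cyl (u n) \<subseteq> {q \<in> topspace fanspace. f q \<in> {y. real n < \<bar>y\<bar>}}"
      by metis
    obtain q where q: "q \<in> topspace fanspace"
      "\<And>U. openin fanspace U \<Longrightarrow> q \<in> U \<Longrightarrow> infinite {n. U \<inter> cyl (u n) \<noteq> {}}"
      using nodes_accumulate[of u] by blast
    let ?U = "{p \<in> topspace fanspace. f p \<in> {y. \<bar>y\<bar> < \<bar>f q\<bar> + 1}}"
    have "open {y::real. \<bar>y\<bar> < \<bar>f q\<bar> + 1}" by (intro open_Collect_less continuous_intros)
    from q(2)[OF pre[OF this]] have inf: "infinite {n. ?U \<inter> cyl (u n) \<noteq> {}}" using q(1) by simp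
    have "n < nat \<lceil>\<bar>f q\<bar> + 1\<rceil>" if n: "?U \<inter> cyl (u n) \<noteq> {}" for n
    proof -
      obtain p where "\<bar>f p\<bar> < \<bar>f q\<bar> + 1" "real n < \<bar>f p\<bar>" using n u[of n] by blast
      then show ?thesis by linarith
    qed
    then have "{n. ?U \<inter> cyl (u n) \<noteq> {}} \<subseteq> {..<nat \<lceil>\<bar>f q\<bar> + 1\<rceil>}" by blast
    then show False using inf finite_subset by blast
  qed
qed

section \<open>The sharp base\<close>

text \<open>Other basic sets around \<open>pt a\<close> come from initial segments of the stem of \<open>a\<close> or from fans whose
code occurs in it, and each such fan contributes finitely many sets.\<close>

lemma pt_in_fanbase_cofinite:
  assumes a: "selected a"
  shows "finite {B \<in> fanbase. pt a \<in> B \<and> (\<forall>k\<ge>K. B \<noteq> nbhd a k)}"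
proof -
  have "\<exists>N. \<forall>k. pt a \<in> nbhd b k \<longrightarrow> k \<le> N" if "selected b" "b \<noteq> a" for b
    using nbhd_index_bound[of b "pt a"] that by auto
  then obtain N where N: "\<And>b k. selected b \<Longrightarrow> b \<noteq> a \<Longrightarrow> pt a \<in> nbhd b k \<Longrightarrow> k \<le> N b"
    by metis
  let ?F = "cyl ` set (prefixes (stem a)) \<union> nbhd a ` {..<K} \<union>
    (\<Union>b\<in>set (stem a). nbhd b ` {..N b})"
  have "{B \<in> fanbase. pt a \<in> B \<and> (\<forall>k\<ge>K. B \<noteq> nbhd a k)} \<subseteq> ?F"
  proof
    fix B assume "B \<in> {B \<in> fanbase. pt a \<in> B \<and> (\<forall>k\<ge>K. B \<noteq> nbhd a k)}"
    then have B: "B \<in> fanbase" "pt a \<in> B" "\<And>k. k \<ge> K \<Longrightarrow> B \<noteq> nbhd a k" by auto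
    from B(1) consider u where "B = cyl u" | b k where "selected b" "B = nbhd b k"
      by (auto simp: fanbase_def)
    then show "B \<in> ?F"
    proof cases
      case 1
      then show ?thesis using B(2) by auto
    next
      case (2 b k)
      show ?thesis
      proof (cases "b = a")
        case True
        then have "k < K" using B(3) 2(2) not_less by blast
        then show ?thesis using 2(2) True by blast
      next
        case False
        then obtain n where "prefix (tip b n) (stem a)"
          using B(2) 2(2) by (auto simp: nbhd_def)
        then have "b \<in> set (stem a)"
          using set_mono_prefix[of "tip b n" "stem a"] by (auto simp: tip_def)
        moreover have "k \<le> N b" using N[OF 2(1) False] B(2) 2(2) by blast
        ultimately show ?thesis using 2(2) by blast
      qed
    qed
  qed
  then show ?thesis by (rule finite_subset) auto
qed

text \<open>Both fans have a tip below \<open>x\<close>; these form the only comparable pair of tips.\<close>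

lemma nbhds_same_stem_meet:
  assumes a: "selected a" and b: "selected b" and st: "stem a = stem b" and ne: "a \<noteq> b"
    and x: "br x \<in> cyl (tip a m)" "br x \<in> nbhd b l"
  shows "nbhd a k \<inter> nbhd b l \<subseteq> cyl (tip a m)"
proof
  fix p assume p: "p \<in> nbhd a k \<inter> nbhd b l"
  have "p \<noteq> pt a" "p \<noteq> pt b"
    using p pt_in_nbhd_same_stem[of a b] pt_in_nbhd_same_stem[of b a] a b st ne by auto
  then obtain m' n' where p': "p \<in> cyl (tip a m')" "p \<in> cyl (tip b n')"
    using p by (auto simp: nbhd_def)
  obtain n where "br x \<in> cyl (tip b n)" using x(2) by (auto simp: nbhd_def)
  then have "comparable (tip a m) (tip b n)" "comparable (tip a m') (tip b n')"
    using cyl_meet x(1) p' by blast+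
  then have "m' = m" using selected_compat[OF a b ne] st unfolding compat_def by blast
  then show "p \<in> cyl (tip a m)" using p'(1) by simp
qed

text \<open>These are the basic sets around \<open>x\<close> that are not contained in the cylinder of level \<open>K\<close>, although
the fan that defines them passes through \<open>x\<close> at level \<open>K\<close> or higher.  There may be infinitely many of them.\<close>

definition straddles :: "(nat \<Rightarrow> letter) \<Rightarrow> nat \<Rightarrow> real set set \<Rightarrow> bool" where
  "straddles x K B \<longleftrightarrow> (\<exists>a m k. selected a \<and> length (stem a) < K \<and> B = nbhd a k \<and>
     below (tip a m) x \<and> K \<le> length (tip a m))"

text \<open>The remaining sets are cylinders over short nodes, and neighbourhoods of fans with a tip of length
less than \<open>K\<close> below \<open>x\<close>, whose codes are among the first \<open>K\<close> letters of \<open>x\<close>.\<close>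

lemma br_in_fanbase_cofinite:
  "finite {B \<in> fanbase. br x \<in> B \<and> \<not> B \<subseteq> cyl (initial x K) \<and> \<not> straddles x K B}" (is "finite ?X")
proof -
  have "\<exists>N. \<forall>k. br x \<in> nbhd b k \<longrightarrow> k \<le> N" if "selected b" for b
    using nbhd_index_bound[of b "br x"] that by auto
  then obtain N where N: "\<And>b k. selected b \<Longrightarrow> br x \<in> nbhd b k \<Longrightarrow> k \<le> N b"
    by metis
  let ?F = "(\<lambda>k. cyl (initial x k)) ` {..<K} \<union> (\<Union>b\<in>set (initial x K). nbhd b ` {..N b})"
  have "?X \<subseteq> ?F"
  proof
    fix B assume "B \<in> ?X"
    then have B: "B \<in> fanbase" "br x \<in> B" "\<not> B \<subseteq> cyl (initial x K)" and no: "\<not> straddles x K B"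
      by simp_all
    from B(1) consider u where "B = cyl u" | b k where "selected b" "B = nbhd b k"
      by (auto simp: fanbase_def)
    then show "B \<in> ?F"
    proof cases
      case (1 u)
      then have u: "below u x" using B(2) by simp
      then have eq: "B = cyl (initial x (length u))" using 1 by (simp add: below_def)
      have "length u < K"
      proof (rule ccontr)
        assume "\<not> length u < K"
        then have "prefix (initial x K) u" using below_prefixI[of "initial x K" x u] u by simp
        then show False using B(3) 1 cyl_mono[of "initial x K" u] by simp
      qed
      then show ?thesis using eq by blast
    next
      case (2 b k)
      obtain m where m: "below (tip b m) x"
        using B(2) 2(2) by (auto simp: nbhd_def)
      have stx: "below (stem b) x"
        using below_prefix[OF m] stem_less_tip[OF selected_fan[OF 2(1)], of m]
        by (auto simp: strict_prefix_def)
      have "length (stem b) < K"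
      proof (rule ccontr)
        assume "\<not> length (stem b) < K"
        then have "prefix (initial x K) (stem b)" using below_prefixI[of "initial x K" x "stem b"] stx by simp
        then show False using B(3) 2 nbhd_subset_cyl[of b "initial x K" k] by simp
      qed
      then have "straddles x K B" if "K \<le> length (tip b m)"
        unfolding straddles_def using 2 m that
        by (intro exI[of _ b] exI[of _ m] exI[of _ k]) simp
      then have "length (tip b m) < K" using no not_le by blast
      then have "prefix (tip b m) (initial x K)" using below_prefix_initial[OF m] by simp
      then have "b \<in> set (initial x K)"
        using set_mono_prefix[of "tip b m" "initial x K"] by (auto simp: tip_def)
      moreover have "k \<le> N b" using N[OF 2(1)] B(2) 2(2) by blast
      ultimately show ?thesis using 2(2) by blast
    qed
  qed
  then show ?thesis by (rule finite_subset) auto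
qed

lemma infinite_inj_avoids:
  fixes B :: "nat \<Rightarrow> 'a"
  assumes "inj B" "finite F" "infinite J"
  shows "\<exists>j\<in>J. B j \<notin> F"
proof (rule ccontr)
  assume "\<not> ?thesis"
  then have "J \<subseteq> B -` F" by blast
  then show False using finite_vimageI[OF assms(2,1)] assms(3) finite_subset by blast
qed

text \<open>At a branch, if no member is small and almost all members straddle level \<open>K\<close>, then by the
pigeonhole principle two of them come from different fans with the same stem, and the intersection
of these two is already small.\<close>

lemma sharp_fanbase: "sharp_base fanspace fanbase"
  unfolding sharp_base_def
proof (intro conjI ballI allI impI base_for_fanbase)
  fix q and B :: "nat \<Rightarrow> real set set"
  assume q: "q \<in> topspace fanspace" and "inj B \<and> (\<forall>n. B n \<in> fanbase \<and> q \<in> B n)"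
  then have inj: "inj B" and B: "\<And>n. B n \<in> fanbase" "\<And>n. q \<in> B n" by auto
  show "local_base_at fanspace q (range (\<lambda>n. \<Inter>j\<le>n. B j))"
    unfolding local_base_at_def
  proof (intro conjI ballI allI impI)
    fix V assume "V \<in> range (\<lambda>n. \<Inter>j\<le>n. B j)"
    then obtain n where V: "V = (\<Inter>j\<le>n. B j)" by blast
    show "openin fanspace V"
      unfolding V using B(1) fanbase_clopen by (intro openin_INT2) auto
    show "q \<in> V" unfolding V using B(2) by blast
  next
    fix U assume U: "openin fanspace U \<and> q \<in> U"
    have "\<exists>i j. B i \<inter> B j \<subseteq> U"
      using q unfolding topspace_fanspace
    proof (cases rule: cyl_cases)
      case (2 a)
      then obtain K where K: "nbhd a K \<subseteq> U" using openin_pt U by blast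
      obtain j where "B j \<notin> {B \<in> fanbase. pt a \<in> B \<and> (\<forall>k\<ge>K. B \<noteq> nbhd a k)}"
        using infinite_inj_avoids[OF inj pt_in_fanbase_cofinite[OF 2(2)] infinite_UNIV_nat] by blast
      then obtain k where "k \<ge> K" "B j = nbhd a k" using B 2(1) by blast
      then have "B j \<inter> B j \<subseteq> U" using K nbhd_antimono by blast
      then show ?thesis by blast
    next
      case (1 x)
      then obtain K where K: "cyl (initial x K) \<subseteq> U" using openin_br U by blast
      show ?thesis
      proof (cases "\<exists>j. B j \<subseteq> cyl (initial x K)")
        case True
        then show ?thesis using K by blast
      next
        case False
        define J where "J = {j. straddles x K (B j)}"
        have "infinite J"
        proof
          assume "finite J"
          then have "infinite (- J)" by (metis finite_compl infinite_UNIV_nat)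
          from infinite_inj_avoids[OF inj br_in_fanbase_cofinite[of x K] this]
          show False using B 1(1) False unfolding J_def by blast
        qed
        have "\<exists>a m k. selected a \<and> length (stem a) < K \<and> B j = nbhd a k \<and>
          below (tip a m) x \<and> K \<le> length (tip a m)" if "j \<in> J" for j
          using that by (simp add: J_def straddles_def)
        then obtain a m k where A: "\<And>j. j \<in> J \<Longrightarrow> selected (a j) \<and> length (stem (a j)) < K \<and>
            B j = nbhd (a j) (k j) \<and> below (tip (a j) (m j)) x \<and> K \<le> length (tip (a j) (m j))"
          by metis
        have "(\<lambda>j. length (stem (a j))) ` J \<subseteq> {..<K}" using A by blast
        then have "finite ((\<lambda>j. length (stem (a j))) ` J)" by (rule finite_subset) simp
        from pigeonhole_infinite[OF \<open>infinite J\<close> this]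
        obtain i where i: "i \<in> J" "infinite {j \<in> J. length (stem (a j)) = length (stem (a i))}" by blast
        obtain N where N: "\<forall>k. br x \<in> nbhd (a i) k \<longrightarrow> k \<le> N"
          using nbhd_index_bound[of "a i" "br x"] A[OF i(1)] by auto
        \<comment> \<open>excluding the finitely many neighbourhoods of \<open>a i\<close> around \<open>x\<close> forces a different fan\<close>
        obtain j where j: "j \<in> J" "length (stem (a j)) = length (stem (a i))"
          "B j \<notin> nbhd (a i) ` {..N}"
          using infinite_inj_avoids[OF inj _ i(2), of "nbhd (a i) ` {..N}"] by blast
        have ne: "a i \<noteq> a j"
        proof
          assume "a i = a j"
          then have eq: "B j = nbhd (a i) (k j)" using A[OF j(1)] by simp
          then have "k j \<le> N" using N B(2)[of j] 1(1) by simp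
          then show False using j(3) eq by simp
        qed
        have stx: "stem (a l) = initial x (length (stem (a l)))" if "l \<in> J" for l
        proof -
          have "below (stem (a l)) x"
            using below_prefix[of "tip (a l) (m l)" x "stem (a l)"] A[OF that]
              stem_less_tip[OF selected_fan, of "a l" "m l"] by (auto simp: strict_prefix_def)
          then show ?thesis by (simp add: below_def)
        qed
        have st: "stem (a i) = stem (a j)" using stx[OF i(1)] stx[OF j(1)] j(2) by simp
        have xj: "br x \<in> nbhd (a j) (k j)" using A[OF j(1)] B(2)[of j] 1(1) by simp
        have "nbhd (a i) (k i) \<inter> nbhd (a j) (k j) \<subseteq> cyl (tip (a i) (m i))"
          by (rule nbhds_same_stem_meet[OF _ _ st ne _ xj]) (use A[OF i(1)] A[OF j(1)] in auto)
        moreover have "cyl (tip (a i) (m i)) \<subseteq> cyl (initial x K)"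
          by (rule cyl_mono, rule below_prefixI[of _ x]) (use A[OF i(1)] in auto)
        ultimately have "B i \<inter> B j \<subseteq> U" using A[OF i(1)] A[OF j(1)] K by auto
        then show ?thesis by blast
      qed
    qed
    then obtain i j where ij: "B i \<inter> B j \<subseteq> U" by blast
    have "(\<Inter>l\<le>max i j. B l) \<subseteq> B i \<inter> B j" by auto
    then show "\<exists>V\<in>range (\<lambda>n. \<Inter>j\<le>n. B j). V \<subseteq> U" using ij by blast
  qed
qed

section \<open>No \<open>G\<^sub>\<delta>\<^sup>*\<close>-diagonal\<close>

lemma metrizable_imp_G_delta_star_diagonal:
  assumes "metrizable_space X" shows "has_G_delta_star_diagonal X"
proof -
  obtain M d where M: "Metric_space M d" and X: "X = Metric_space.mtopology M d"
    using assms unfolding metrizable_space_def by blast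
  interpret Metric_space M d by (rule M)
  define G where "G n = (\<lambda>x. mball x (1 / Suc n)) ` M" for n :: nat
  show ?thesis unfolding has_G_delta_star_diagonal_def
  proof (intro exI conjI allI ballI)
    show "open_cover X (G n)" for n
      by (auto simp: open_cover_def G_def X)
  next
    fix x assume "x \<in> topspace X"
    then have x: "x \<in> M" by (simp add: X)
    have "y = x" if y: "\<forall>n. y \<in> X closure_of star x (G n)" for y
    proof (rule ccontr)
      assume "y \<noteq> x"
      have yM: "y \<in> M" using y by (auto simp: in_closure_of X)
      then have pos: "d x y > 0" using x \<open>y \<noteq> x\<close> by (simp add: mdist_pos_less)
      obtain n where n: "1 / real (Suc n) < d x y / 3"
        using reals_Archimedean[of "d x y / 3"] pos by (auto simp: inverse_eq_divide)
      have "y \<in> mball y (1 / Suc n)" "openin X (mball y (1 / Suc n))"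
        using yM by (auto simp: X)
      then obtain z where z: "z \<in> star x (G n)" "z \<in> mball y (1 / Suc n)"
        using y[rule_format, of n] unfolding in_closure_of by blast
      then obtain c where "c \<in> M" "x \<in> mball c (1 / Suc n)" "z \<in> mball c (1 / Suc n)"
        by (auto simp: star_def G_def)
      then have "d c x < 1 / Suc n" "d c z < 1 / Suc n" "d y z < 1 / Suc n" "c \<in> M" "z \<in> M"
        using z by auto
      moreover have "d x y \<le> d x c + (d c z + d z y)"
        using triangle[of x c y] triangle[of c z y] x yM \<open>c \<in> M\<close> \<open>z \<in> M\<close> by linarith
      ultimately show False using n commute[of x c] commute[of z y] by linarith
    qed
    moreover have "x \<in> X closure_of star x (G n)" for n
    proof -
      have "x \<in> star x (G n)"
        using x unfolding star_def G_def by (auto intro!: bexI[of _ x])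
      then show ?thesis using x by (auto simp: in_closure_of X)
    qed
    ultimately show "(\<Inter>n. X closure_of star x (G n)) = {x}" by blast
  qed
qed

text \<open>Here \<open>k\<close> assigns to each fan point the neighbourhood \<open>nbhd a (k a)\<close>; the node \<open>u\<close> is captured if
some tip inside the assigned neighbourhood of a fan with empty stem extends it.\<close>

definition captured :: "(letter \<Rightarrow> nat) \<Rightarrow> node \<Rightarrow> bool" where
  "captured k u \<longleftrightarrow> (\<exists>a m. selected a \<and> stem a = [] \<and> k a \<le> m \<and> prefix u (tip a m))"

lemma countable_uncaptured: "countable {d. \<exists>u. prefix [d] u \<and> \<not> captured k u}" (is "countable ?S")
proof (rule ccontr)
  assume unc: "\<not> countable ?S"
  have "\<forall>d\<in>?S. \<exists>u. prefix [d] u \<and> \<not> captured k u" by simp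
  then obtain w where w: "\<forall>d\<in>?S. prefix [d] (w d) \<and> \<not> captured k (w d)" by (rule bchoice[THEN exE])
  have "\<exists>a. selected a \<and> stem a = [] \<and> (\<forall>l. \<exists>m\<ge>l. \<exists>n\<ge>l. \<exists>d\<in>?S. prefix (w d) (tip a m))"
    by (rule selected_uncountable[OF unc, of "\<lambda>d n. w d"]) (use w in blast)
  then obtain a where a: "selected a" "stem a = []"
    and "\<forall>l. \<exists>m\<ge>l. \<exists>n\<ge>l. \<exists>d\<in>?S. prefix (w d) (tip a m)" by (elim exE conjE)
  then obtain m d where "m \<ge> k a" "d \<in> ?S" "prefix (w d) (tip a m)" by meson
  then have "captured k (w d)" using a unfolding captured_def by blast
  then show False using w \<open>d \<in> ?S\<close> by blast
qed

text \<open>All but countably many directions \<open>d\<close> have all nodes above them captured, for all \<open>n\<close> at once.  Above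
such a \<open>d\<close> the capturing tips can be stacked into one branch.\<close>

lemma captured_branch:
  fixes k :: "nat \<Rightarrow> letter \<Rightarrow> nat"
  shows "\<exists>d x. below [d] x \<and>
    (\<forall>n. \<exists>a m. selected a \<and> stem a = [] \<and> k n a \<le> m \<and> below (tip a m) x)"
proof -
  have "countable (\<Union>n. {d. \<exists>u. prefix [d] u \<and> \<not> captured (k n) u})"
    using countable_uncaptured by (intro countable_UN) auto
  then have "(\<Union>n. {d. \<exists>u. prefix [d] u \<and> \<not> captured (k n) u}) \<noteq> UNIV"
    using uncountable_letter by auto
  then obtain d where d: "\<And>n u. prefix [d] u \<Longrightarrow> captured (k n) u" by blast
  let ?P = "\<lambda>n u v. \<exists>a m. selected a \<and> stem a = [] \<and> k n a \<le> m \<and> v = tip a m \<and> strict_prefix u v"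
  have "\<exists>u. \<forall>n. prefix [d] (u n) \<and> ?P n (u n) (u (Suc n))"
  proof (rule dependent_nat_choice)
    show "\<exists>u. prefix [d] u" by blast
    fix u n assume u: "prefix [d] u"
    then have "prefix [d] (u @ [d])" by simp
    from d[OF this, of n] obtain a m
      where am: "selected a" "stem a = []" "k n a \<le> m" "prefix (u @ [d]) (tip a m)"
      unfolding captured_def by blast
    then have "strict_prefix u (tip a m)" "prefix [d] (tip a m)"
      using u by (auto simp: strict_prefix_def prefix_def)
    then show "\<exists>v. prefix [d] v \<and> ?P n u v" using am by blast
  qed
  then obtain u where u: "\<And>n. prefix [d] (u n)" "\<And>n. ?P n (u n) (u (Suc n))" by blast
  then obtain x where x: "\<And>n. below (u n) x" using branch_through[of u] by blast
  have "\<exists>a m. selected a \<and> stem a = [] \<and> k n a \<le> m \<and> below (tip a m) x" for n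
  proof -
    obtain a m where am: "selected a" "stem a = []" "k n a \<le> m" "u (Suc n) = tip a m"
      using u(2)[of n] by blast
    then have "below (tip a m) x" using x[of "Suc n"] by simp
    then show ?thesis using am by blast
  qed
  moreover have "below [d] x" using below_prefix[OF x u(1)] .
  ultimately show ?thesis by blast
qed

lemma covers_nbhd_index:
  assumes G: "\<And>n. open_cover fanspace (G n)"
  shows "\<exists>k :: nat \<Rightarrow> letter \<Rightarrow> nat.
    \<forall>n a j. selected a \<longrightarrow> j \<le> n \<longrightarrow> (\<exists>V\<in>G j. nbhd a (k n a) \<subseteq> V)"
proof -
  define k where "k j a = (SOME k. \<exists>V\<in>G j. nbhd a k \<subseteq> V)" for j a
  have k: "\<exists>V\<in>G j. nbhd a (k j a) \<subseteq> V" if a: "selected a" for j a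
  proof -
    have "pt a \<in> \<Union>(G j)" using G[of j] a by (simp add: open_cover_def topspace_fanspace)
    then obtain V where V: "V \<in> G j" "pt a \<in> V" by blast
    moreover have "openin fanspace V" using G[of j] V(1) by (simp add: open_cover_def)
    ultimately have "\<exists>k. \<exists>V\<in>G j. nbhd a k \<subseteq> V" using openin_pt[of V a] by blast
    then show ?thesis unfolding k_def by (rule someI_ex)
  qed
  have "\<exists>V\<in>G j. nbhd a (Max ((\<lambda>j. k j a) ` {..n})) \<subseteq> V" if "selected a" "j \<le> n" for n a j
  proof -
    have "k j a \<le> Max ((\<lambda>j. k j a) ` {..n})" using that by simp
    then show ?thesis using k[OF that(1), of j] nbhd_antimono by blast
  qed
  then show ?thesis by (intro exI[of _ "\<lambda>n a. Max ((\<lambda>j. k j a) ` {..n})"]) blast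
qed

text \<open>The neighbourhoods around \<open>x\<close> given by \<open>captured_branch\<close> lie in the stars of \<open>x\<close>.  The tip after the
one below \<open>x\<close> points in another direction; these tips accumulate at a point outside the clopen
cylinder \<open>cyl [d]\<close> around \<open>x\<close>, and this point is in the closure of every star.\<close>

lemma no_G_delta_star_fanspace: "\<not> has_G_delta_star_diagonal fanspace"
proof
  assume "has_G_delta_star_diagonal fanspace"
  then obtain G :: "nat \<Rightarrow> real set set set" where "(\<forall>n. open_cover fanspace (G n)) \<and>
      (\<forall>x\<in>topspace fanspace. (\<Inter>n. fanspace closure_of (star x (G n))) = {x})"
    unfolding has_G_delta_star_diagonal_def by (rule exE)
  then have G: "open_cover fanspace (G n)"
    and diag: "x \<in> topspace fanspace \<Longrightarrow> (\<Inter>n. fanspace closure_of (star x (G n))) = {x}" for n x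
    by simp_all
  obtain k :: "nat \<Rightarrow> letter \<Rightarrow> nat"
    where k: "\<forall>n a j. selected a \<longrightarrow> j \<le> n \<longrightarrow> (\<exists>V\<in>G j. nbhd a (k n a) \<subseteq> V)"
    using covers_nbhd_index[OF G] by (rule exE)
  obtain d x where dx: "below [d] x"
    and x: "\<And>n. \<exists>a m. selected a \<and> stem a = [] \<and> k n a \<le> m \<and> below (tip a m) x"
    using captured_branch[of k] by blast
  have "\<exists>v. \<not> prefix [d] v \<and> v \<noteq> [] \<and> (\<forall>j\<le>n. cyl v \<subseteq> star (br x) (G j))" for n
  proof -
    obtain a m where am: "selected a" "stem a = []" "k n a \<le> m" "below (tip a m) x"
      using x[of n] by blast
    let ?v = "tip a (Suc m)"
    have fan: "fan a" using am(1) by (rule selected_fan)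
    have "prefix [dir a m] (tip a m)" "prefix [dir a (Suc m)] ?v"
      using dir_tip[OF fan, of m] dir_tip[OF fan, of "Suc m"] am(2) by simp_all
    moreover have "comparable [d] (tip a m)" using below_comparable[OF dx am(4)] .
    moreover have "dir a m \<noteq> dir a (Suc m)" using fan_dir_inj[OF fan] by simp
    ultimately have nd: "\<not> prefix [d] ?v" "?v \<noteq> []" by (auto simp: prefix_def append_eq_Cons_conv Cons_eq_append_conv)
    have "cyl ?v \<subseteq> star (br x) (G j)" if j: "j \<le> n" for j
    proof -
      obtain V where V: "V \<in> G j" "nbhd a (k n a) \<subseteq> V" using k am(1) j by blast
      have "br x \<in> cyl (tip a m)" using am(4) by simp
      then have "br x \<in> V" using V(2) tip_subset_nbhd[OF am(3), of a] by blast
      moreover have "cyl ?v \<subseteq> V" using V(2) tip_subset_nbhd[of "k n a" "Suc m" a] am(3) by auto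
      ultimately show ?thesis using V(1) by (auto simp: star_def)
    qed
    then show ?thesis using nd by blast
  qed
  then have "\<forall>n. \<exists>v. \<not> prefix [d] v \<and> v \<noteq> [] \<and> (\<forall>j\<le>n. cyl v \<subseteq> star (br x) (G j))" ..
  then obtain v :: "nat \<Rightarrow> node" where v: "\<forall>n. \<not> prefix [d] (v n) \<and> v n \<noteq> [] \<and> (\<forall>j\<le>n. cyl (v n) \<subseteq> star (br x) (G j))"
    by (rule choice[THEN exE])
  obtain q where q: "q \<in> topspace fanspace"
    "\<And>U. openin fanspace U \<Longrightarrow> q \<in> U \<Longrightarrow> infinite {n. U \<inter> cyl (v n) \<noteq> {}}"
    using nodes_accumulate[of v] by blast
  have "q \<in> fanspace closure_of (star (br x) (G j))" for j
    unfolding in_closure_of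
  proof (intro conjI allI impI q(1))
    fix T assume T: "q \<in> T \<and> openin fanspace T"
    then have "infinite {n. T \<inter> cyl (v n) \<noteq> {}}" using q(2)[of T] by simp
    then obtain n where n: "n \<ge> j" "n \<in> {n. T \<inter> cyl (v n) \<noteq> {}}"
      unfolding infinite_nat_iff_unbounded_le by blast
    then have "cyl (v n) \<subseteq> star (br x) (G j)" using v by simp
    then show "\<exists>y. y \<in> star (br x) (G j) \<and> y \<in> T" using n(2) by blast
  qed
  then have "q = br x" using diag[of "br x"] by (auto simp: topspace_fanspace)
  moreover have "q \<notin> cyl [d]"
  proof
    assume "q \<in> cyl [d]"
    then have "{n. cyl [d] \<inter> cyl (v n) \<noteq> {}} \<noteq> {}" using q(2)[OF openin_cyl] by force
    then obtain n where "cyl [d] \<inter> cyl (v n) \<noteq> {}" by blast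
    then have "comparable [d] (v n)" using cyl_meet by blast
    moreover have "\<not> prefix [d] (v n)" "v n \<noteq> []" using v by simp_all
    ultimately show False by (auto simp: prefix_Cons)
  qed
  ultimately show False using dx by simp
qed

lemma not_metrizable_fanspace: "\<not> metrizable_space fanspace"
  using metrizable_imp_G_delta_star_diagonal no_G_delta_star_fanspace by blast

section \<open>The product with the unit interval\<close>

text \<open>In the application, \<open>k a\<close> also controls the height of a rectangle around \<open>(pt a, 1/2)\<close>, and
\<open>k a \<le> n\<close> says that the rectangle reaches the
\<open>n\<close>-th term of a sequence of heights converging to \<open>1/2\<close>.\<close>

definition densely_captured :: "(letter \<Rightarrow> nat) \<Rightarrow> nat \<Rightarrow> node \<Rightarrow> bool" where
  "densely_captured k n u \<longleftrightarrow> (\<forall>v. prefix u v \<longrightarrow>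
     (\<exists>a m. selected a \<and> stem a = [] \<and> k a \<le> m \<and> k a \<le> n \<and> prefix v (tip a m)))"

text \<open>Otherwise, for each direction \<open>d\<close> and each \<open>n\<close> there is a node \<open>w d n\<close> above \<open>[d]\<close>
that is not captured with bound \<open>n\<close>.  A fan with tips that extend \<open>w d n\<close> for
arbitrarily large \<open>n\<close> then contradicts \<open>k a \<le> n\<close> for \<open>n\<close> large.\<close>

lemma densely_captured_exists:
  "\<exists>n d. densely_captured k n [d]"
proof (rule ccontr)
  assume neg: "\<not> ?thesis"
  define Q where "Q d n v \<longleftrightarrow> prefix [d] v \<and>
    \<not> (\<exists>a m. selected a \<and> stem a = [] \<and> k a \<le> m \<and> k a \<le> n \<and> prefix v (tip a m))" for d n v
  define w where "w d n = (SOME v. Q d n v)" for d n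
  have "\<exists>v. Q d n v" for d n
    using neg unfolding densely_captured_def Q_def by blast
  then have w: "Q d n (w d n)" for d n unfolding w_def by (rule someI_ex)
  have "\<exists>a. selected a \<and> stem a = [] \<and>
      (\<forall>l. \<exists>m\<ge>l. \<exists>n\<ge>l. \<exists>d\<in>UNIV. prefix (w d n) (tip a m))"
    by (rule selected_uncountable[OF uncountable_letter]) (use w in \<open>simp add: Q_def\<close>)
  then obtain a where a: "selected a" "stem a = []"
    and "\<forall>l. \<exists>m\<ge>l. \<exists>n\<ge>l. \<exists>d\<in>UNIV. prefix (w d n) (tip a m)" by blast
  then obtain m n d where "m \<ge> k a" "n \<ge> k a" "prefix (w d n) (tip a m)" by meson
  then show False using w[of d n] a unfolding Q_def by blast
qed

lemma branch_in_many_nbhds: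
  "\<exists>n x (a :: nat \<Rightarrow> letter). inj a \<and> (\<forall>i. selected (a i) \<and> stem (a i) = [] \<and> k (a i) \<le> n \<and>
     br x \<in> nbhd (a i) (k (a i)))"
proof -
  obtain n d where dc: "densely_captured k n [d]" using densely_captured_exists by blast
  let ?P = "\<lambda>u v. \<exists>a m. selected a \<and> stem a = [] \<and> k a \<le> m \<and> k a \<le> n \<and> v = tip a m \<and> strict_prefix u v"
  have "\<exists>u. \<forall>i. prefix [d] (u i) \<and> ?P (u i) (u (Suc i))"
  proof (rule dependent_nat_choice)
    show "\<exists>u. prefix [d] u" by blast
    fix u and i :: nat assume u: "prefix [d] u"
    then have "prefix [d] (u @ [d])" by simp
    then obtain a m
      where am: "selected a" "stem a = []" "k a \<le> m" "k a \<le> n" "prefix (u @ [d]) (tip a m)"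
      using dc unfolding densely_captured_def by blast
    then have "strict_prefix u (tip a m)" "prefix [d] (tip a m)"
      using u by (auto simp: strict_prefix_def prefix_def)
    then show "\<exists>v. prefix [d] v \<and> ?P u v" using am by blast
  qed
  then obtain u :: "nat \<Rightarrow> node" where u: "\<forall>i. prefix [d] (u i) \<and> ?P (u i) (u (Suc i))" by (rule exE)
  then have sp: "strict_prefix (u i) (u (Suc i))" for i by blast
  obtain x where x: "\<And>i. below (u i) x" using branch_through[of u] sp by blast
  have "\<forall>i. \<exists>a. selected a \<and> stem a = [] \<and> k a \<le> n \<and> (\<exists>m\<ge>k a. u (Suc i) = tip a m)"
    using u by blast
  then obtain a :: "nat \<Rightarrow> letter" where a: "\<forall>i. selected (a i) \<and> stem (a i) = [] \<and> k (a i) \<le> n \<and>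
      (\<exists>m\<ge>k (a i). u (Suc i) = tip (a i) m)" by (rule choice[THEN exE])
  have x_in: "br x \<in> nbhd (a i) (k (a i))" for i
  proof -
    obtain m where "m \<ge> k (a i)" "u (Suc i) = tip (a i) m" using a by blast
    then show ?thesis using x[of "Suc i"] tip_subset_nbhd[of "k (a i)" m "a i"] by auto
  qed
  have "inj a"
  proof (rule linorder_injI)
    fix i j :: nat assume "i < j"
    show "a i \<noteq> a j"
    proof
      assume eq: "a i = a j"
      obtain m m' where m: "u (Suc i) = tip (a i) m" "u (Suc j) = tip (a i) m'"
        using a eq by metis
      then have "br x \<in> cyl (tip (a i) m)" "br x \<in> cyl (tip (a i) m')"
        using x[of "Suc i"] x[of "Suc j"] by simp_all
      then have "m = m'" using tips_meet a by blast
      then have "length (u (Suc i)) = length (u (Suc j))" using m by simp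
      moreover have "strict_mono (\<lambda>i. length (u i))"
        using prefix_length_less[OF sp] by (simp add: strict_mono_Suc_iff)
      ultimately show False using strict_monoD[of "\<lambda>i. length (u i)" "Suc i" "Suc j"] \<open>i < j\<close> by simp
    qed
  qed
  then show ?thesis using a x_in by blast
qed

text \<open>The basic sets \<open>B (a i)\<close> are distinct, because \<open>B a\<close> lies over \<open>nbhd a 0\<close>, which contains no other fan
point with the same stem.  All of them contain both \<open>(br x, 1/2)\<close> and \<open>(br x, t n)\<close>, so
they cannot shrink to a local base at the former.\<close>

lemma no_sharp_base_product: "\<not> has_sharp_base (prod_topology fanspace (top_of_set {0..1::real}))"
proof
  let ?Q = "prod_topology fanspace (top_of_set {0..1::real})"
  define t where "t n = 1/2 + 1 / (real n + 2)" for n :: nat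
  have t: "0 < t n" "t n \<le> 1" "1/2 < t n" for n by (simp_all add: t_def field_simps)
  have "(\<lambda>n. 1 / (real n + 2)) \<longlonglongrightarrow> 0"
    using LIMSEQ_ignore_initial_segment[OF lim_1_over_n, of 2] by (simp add: add.commute)
  from tendsto_add[OF tendsto_const this, of "1/2"] have tlim: "t \<longlonglongrightarrow> 1/2"
    by (simp add: t_def[abs_def])
  assume "has_sharp_base ?Q"
  then obtain \<B> :: "(real set \<times> real) set set" where sharp: "sharp_base ?Q \<B>"
    unfolding has_sharp_base_def by (rule exE)
  have "openin ?Q = arbitrary union_of (\<lambda>U. U \<in> \<B>)"
    using sharp unfolding sharp_base_def base_for_def by blast
  then have bopen: "\<And>V. V \<in> \<B> \<Longrightarrow> openin ?Q V"
    and bref: "\<And>U p. openin ?Q U \<Longrightarrow> p \<in> U \<Longrightarrow> \<exists>V. V \<in> \<B> \<and> p \<in> V \<and> V \<subseteq> U"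
    unfolding openin_topology_base_unique by blast+
  have half: "openin ?Q (nbhd a 0 \<times> {0..1})" if "selected a" for a
    using openin_nbhd[OF that] by (simp add: openin_prod_Times_iff)
  have Bex: "\<exists>B. B \<in> \<B> \<and> (pt a, 1/2) \<in> B \<and> B \<subseteq> nbhd a 0 \<times> {0..1}" if "selected a" for a
    by (rule bref[OF half[OF that]]) simp
  define B where "B a = (SOME B. B \<in> \<B> \<and> (pt a, 1/2) \<in> B \<and> B \<subseteq> nbhd a 0 \<times> {0..1})" for a
  have B: "B a \<in> \<B> \<and> (pt a, 1/2) \<in> B a \<and> B a \<subseteq> nbhd a 0 \<times> {0..1}" if "selected a" for a
    unfolding B_def by (rule someI_ex[OF Bex[OF that]])
  have kex: "\<exists>k. \<forall>n\<ge>k. nbhd a k \<times> {1/2, t n} \<subseteq> B a" if a: "selected a" for a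
  proof -
    obtain U V where UV: "openin fanspace U" "openin (top_of_set {0..1::real}) V" "pt a \<in> U" "1/2 \<in> V" "U \<times> V \<subseteq> B a"
      using bopen[of "B a"] B[OF a] unfolding openin_prod_topology_alt by blast
    obtain k where k: "nbhd a k \<subseteq> U" using openin_pt[OF UV(1,3)] ..
    obtain W where W: "open W" "V = {0..1} \<inter> W" using UV(2) by (auto simp: openin_open)
    have "eventually (\<lambda>n. t n \<in> W) sequentially"
      using topological_tendstoD[OF tlim W(1)] UV(4) W(2) by simp
    then obtain N where N: "\<And>n. n \<ge> N \<Longrightarrow> t n \<in> W" by (auto simp: eventually_sequentially)
    have "nbhd a (max k N) \<times> {1/2, t n} \<subseteq> B a" if n: "n \<ge> max k N" for n
    proof -
      have "t n \<in> V" using N[of n] n W(2) t(1,2)[of n] by simp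
      moreover have "nbhd a (max k N) \<subseteq> U" using k nbhd_antimono[of k "max k N" a] by simp
      ultimately show ?thesis using UV(4,5) by blast
    qed
    then show ?thesis by blast
  qed
  define k where "k a = (SOME k. \<forall>n\<ge>k. nbhd a k \<times> {1/2, t n} \<subseteq> B a)" for a
  have "\<forall>n\<ge>k a. nbhd a (k a) \<times> {1/2, t n} \<subseteq> B a" if "selected a" for a
    unfolding k_def by (rule someI_ex[OF kex[OF that]])
  then have k: "nbhd a (k a) \<times> {1/2, t n} \<subseteq> B a" if "selected a" "k a \<le> n" for a n
    using that by blast
  obtain n x and a :: "nat \<Rightarrow> letter" where inj: "inj a"
    and "\<forall>i. selected (a i) \<and> stem (a i) = [] \<and> k (a i) \<le> n \<and> br x \<in> nbhd (a i) (k (a i))"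
    using branch_in_many_nbhds[of k] by (elim exE conjE)
  then have a: "selected (a i)" "stem (a i) = []" "k (a i) \<le> n" "br x \<in> nbhd (a i) (k (a i))" for i
    by simp_all
  have injB: "inj (\<lambda>i. B (a i))"
  proof (rule injI)
    fix i j assume "B (a i) = B (a j)"
    then have "pt (a i) \<in> nbhd (a j) 0" using B[OF a(1), of i] B[OF a(1), of j] by auto
    then have "a i = a j" using pt_in_nbhd_same_stem[OF a(1)] a(2) by simp
    then show "i = j" using inj by (simp add: inj_eq)
  qed
  have xB: "(br x, 1/2) \<in> B (a i)" "(br x, t n) \<in> B (a i)" for i
    using k[OF a(1) a(3), of i] a(4)[of i] by blast+
  have "(br x, 1/2) \<in> topspace ?Q" by (simp add: topspace_fanspace)
  moreover have "inj (\<lambda>i. B (a i)) \<and> (\<forall>i. B (a i) \<in> \<B> \<and> (br x, 1/2) \<in> B (a i))"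
    using injB B[OF a(1)] xB(1) by blast
  ultimately have lb: "local_base_at ?Q (br x, 1/2) (range (\<lambda>m. \<Inter>j\<le>m. B (a j)))"
    using sharp unfolding sharp_base_def by blast
  let ?U = "cyl [] \<times> ({0..1} \<inter> {..<t n})"
  have "openin ?Q ?U"
    by (simp add: openin_prod_Times_iff openin_cyl openin_open_Int)
  moreover have "(br x, 1/2) \<in> ?U" using t(3)[of n] by simp
  ultimately obtain m where "(\<Inter>j\<le>m. B (a j)) \<subseteq> ?U"
    using lb unfolding local_base_at_def by blast
  moreover have "(br x, t n) \<in> (\<Inter>j\<le>m. B (a j))" using xB(2) by blast
  ultimately show False by auto
qed

theorem mainTheorem1:
  shows "\<exists>P :: real set topology.
    tychonoff_space P \<and>
    pseudocompact_space P \<and>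
    \<not> metrizable_space P \<and>
    has_sharp_base P \<and>
    \<not> has_G_delta_star_diagonal P \<and>
    \<not> has_sharp_base (prod_topology P (top_of_set {0..1::real}))"
  using tychonoff_fanspace pseudocompact_fanspace not_metrizable_fanspace sharp_fanbase
    no_G_delta_star_fanspace no_sharp_base_product unfolding has_sharp_base_def by blast

end
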